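(* Let $K$ be a field, let $P=K[x_1,\dots,x_n]$ be positively graded by $W\in\mathrm{Mat}_{1,n}(\mathbb{Z})$, let $X=(x_1,\dots,x_n)$ and $\mathfrak{M}=\langle x_1,\dots,x_n\rangle$, let $G=(g_1,\dots,g_r)$ be a tuple of $W$-homogeneous polynomials in $\mathfrak{M}$, and let $I=\langle g_1,\dots,g_r\rangle$. Then the following steps can be carried out. (1) Let $s=\dim_K(\mathrm{Lin}_{\mathfrak{M}}(I))$. Choose a subtuple $(f_1,\dots,f_s)$ of $G$ such that $(\mathrm{Lin}_{\mathfrak{M}}(f_1),\dots,\mathrm{Lin}_{\mathfrak{M}}(f_s))$ is a $K$-basis of $\mathrm{Lin}_{\mathfrak{M}}(I)$. (2) Choose a tuple of pairwise distinct indeterminates $Z=(z_1,\dots,z_s)$ which is of top rank with respect to $\mathrm{Lin}_{\mathfrak{M}}(I)$ and such that $z_i\in\mathrm{Supp}(\mathrm{Lin}_{\mathfrak{M}}(f_i))$ for $i=1,\dots,s$, indexed such that $\deg_W(z_1)\le\cdots\le\deg_W(z_s)$. (3) By $K$-linearly interreducing $(f_1,\dots,f_s)$, compute $W$-homogeneous polynomials $f_1',\dots,f_s'$ in the $K$-span of $f_1,\dots,f_s$ such that $f_i'=z_i-h_i$ with $h_i\in P$ and $\mathrm{Lin}_{\mathfrak{M}}(h_i)\in K[X\setminus Z]$. (4) Successively for $i=1,\dots,s-1$ and $j=i+1,\dots,s$, substitute $z_i$ in (the current) $f_j'$ by (the current) $h_i$, where the current $h_i$ is defined by $f_i'=z_i-h_i$.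 Let $\tilde f_1,\dots,\tilde f_s$ be the polynomials resulting from these substitutions. Moreover, for any choices in these steps, $\widetilde F=(\tilde f_1,\dots,\tilde f_s)$ is a coherently $Z$-separating tuple of $W$-homogeneous polynomials in $I$, and the corresponding $Z$-separating re-embedding $\Phi:\;P/I\cong K[X\setminus Z]/(I\cap K[X\setminus Z])$ is an optimal re-embedding of $I$.
   Context: Grading: $W=(w_1,\dots,w_n)$ defines the $\mathbb{Z}$-grading with $\deg_W(x_i)=w_i$; it is positive if all $w_i>0$. Linear part: for $f\in\mathfrak{M}$, $\mathrm{Lin}_{\mathfrak{M}}(f)$ is the homogeneous component of $f$ of standard degree $1$; $\mathrm{Lin}_{\mathfrak{M}}(I)$ is the $K$-vector space spanned by $\mathrm{Lin}_{\mathfrak{M}}(f)$ for $f\in I$. $\mathrm{Supp}(f)$ is the set of power products occurring in $f$ with nonzero coefficient. A tuple $Z$ of $s$ distinct indeterminates is of top rank with respect to $\mathrm{Lin}_{\mathfrak{M}}(I)$ if, for linear forms $\ell_i=a_{i1}x_1+\cdots+a_{in}x_n$ spanning $\mathrm{Lin}_{\mathfrak{M}}(I)$, the submatrix of $(a_{ij})$ consisting of the columns corresponding to $Z$ has rank $s$. A tuple $F=(f_1,\dots,f_s)$ is coherently $Z$-separating if $f_i=z_i-h_i$ with polynomials $h_i$ such that $z_i$ divides no term in $\mathrm{Supp}(h_j)$ for all $i,j$. If such an $F$ lies in $I$, the $K$-algebra isomorphism $\Phi:P/I\to K[X\setminus Z]/(I\cap K[X\setminus Z])$ given by $z_i\mapsto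 h_i$ and $x_j\mapsto x_j$ for $x_j\notin Z$ is called the ($Z$-separating) re-embedding of $I$ corresponding to $F$. Here $X\setminus Z$ is the tuple of indeterminates not in $Z$. A $K$-algebra isomorphism $\Phi:P/I\to P'/I'$, where $P'=K[y_1,\dots,y_m]$ is a polynomial ring and $I'$ an ideal in $P'$, is an optimal re-embedding of $I$ if $m$ is the minimum possible number among all such isomorphisms. *)

theory Defs
  imports
    "HOL-Library.Poly_Mapping"
    "HOL-Library.Multiset"
    "HOL-Library.Sublist"
    "HOL-Algebra.QuotRing"
    "Jordan_Normal_Form.DL_Rank"
begin

section \<open>Polynomials\<close>

text \<open>Indeterminates are named by natural numbers. A power product is an exponent vector
  (written additively), and \<open>K[V]\<close> is the subring of all polynomials whose indeterminates lie in
  the set \<open>V\<close>; so \<open>K[x\<^sub>1,\<dots>,x\<^sub>n]\<close> is \<open>polyring {1..n}\<close>.\<close>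

type_synonym pprod = "nat \<Rightarrow>\<^sub>0 nat"

type_synonym 'k mpoly = "pprod \<Rightarrow>\<^sub>0 'k"

definition Const :: "'k::comm_ring_1 \<Rightarrow> 'k mpoly" where
  "Const c = Poly_Mapping.single 0 c"

definition Indet_pp :: "nat \<Rightarrow> pprod" where
  "Indet_pp i = Poly_Mapping.single i 1"

definition Indet :: "nat \<Rightarrow> 'k::comm_ring_1 mpoly" where
  "Indet i = Poly_Mapping.single (Indet_pp i) 1"

definition pp_dvd :: "pprod \<Rightarrow> pprod \<Rightarrow> bool" where
  "pp_dvd s t \<longleftrightarrow> (\<exists>u. t = s + u)"

definition Supp :: "'k::comm_ring_1 mpoly \<Rightarrow> pprod set" where
  "Supp p = Poly_Mapping.keys p"

definition indets :: "'k::comm_ring_1 mpoly \<Rightarrow> nat set" where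
  "indets p = (\<Union>t\<in>Supp p. Poly_Mapping.keys t)"

definition polyring :: "nat set \<Rightarrow> 'k::comm_ring_1 mpoly ring" where
  "polyring V = \<lparr>carrier = {p. indets p \<subseteq> V}, monoid.mult = (*), one = 1, zero = 0, add = (+)\<rparr>"

definition subst :: "(nat \<Rightarrow> 'k::comm_ring_1 mpoly) \<Rightarrow> 'k mpoly \<Rightarrow> 'k mpoly" where
  "subst \<sigma> p = (\<Sum>t\<in>Supp p. Const (Poly_Mapping.lookup p t) *
      (\<Prod>i\<in>Poly_Mapping.keys t. \<sigma> i ^ Poly_Mapping.lookup t i))"

definition subst_indet :: "nat \<Rightarrow> 'k::comm_ring_1 mpoly \<Rightarrow> 'k mpoly \<Rightarrow> 'k mpoly" where
  "subst_indet z h = subst (Indet(z := h))"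

lemma indets_add: "indets (p + q) \<subseteq> indets p \<union> indets q"
  using Poly_Mapping.keys_add[of p q] by (auto simp: indets_def Supp_def)

lemma indets_mult: "indets (p * q) \<subseteq> indets p \<union> indets q"
proof
  fix i assume "i \<in> indets (p * q)"
  then obtain t where t: "t \<in> Poly_Mapping.keys (p * q)" "i \<in> Poly_Mapping.keys t"
    by (auto simp: indets_def Supp_def)
  then obtain a b where "a \<in> Poly_Mapping.keys p" "b \<in> Poly_Mapping.keys q" "t = a + b"
    using Poly_Mapping.keys_mult[of p q] by blast
  with t show "i \<in> indets p \<union> indets q"
    using Poly_Mapping.keys_add[of a b] by (auto simp: indets_def Supp_def)
qed

lemma indets_uminus: "indets (- p) = indets p"
  by (simp add: indets_def Supp_def keys_def)

lemma indets_zero: "indets 0 = {}"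
  by (simp add: indets_def Supp_def)

lemma indets_one: "indets (1 :: 'k::comm_ring_1 mpoly) = {}"
  by (simp add: indets_def Supp_def flip: single_one)

lemma cring_polyring: "cring (polyring V :: 'k::comm_ring_1 mpoly ring)"
proof (intro cringI abelian_groupI comm_monoidI)
  fix p :: "'k mpoly" assume "p \<in> carrier (polyring V)"
  then show "\<exists>q\<in>carrier (polyring V). q \<oplus>\<^bsub>polyring V\<^esub> p = \<zero>\<^bsub>polyring V\<^esub>"
    by (intro bexI[of _ "- p"]) (auto simp: polyring_def indets_uminus)
qed (auto simp: polyring_def algebra_simps indets_zero indets_one
       dest!: subsetD[OF indets_add] subsetD[OF indets_mult])

section \<open>The \<open>K\<close>-vector space structure, gradings, linear parts\<close>

definition cscale :: "'k::comm_ring_1 \<Rightarrow> 'k mpoly \<Rightarrow> 'k mpoly" where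
  "cscale c p = Const c * p"

global_interpretation kspace: vector_space "cscale :: 'k::field \<Rightarrow> 'k mpoly \<Rightarrow> 'k mpoly"
  by unfold_locales
    (simp_all add: cscale_def Const_def algebra_simps single_add mult_single
      flip: mult.assoc)

definition wdeg :: "(nat \<Rightarrow> int) \<Rightarrow> pprod \<Rightarrow> int" where
  "wdeg W t = (\<Sum>i\<in>Poly_Mapping.keys t. W i * int (Poly_Mapping.lookup t i))"

definition positive_grading :: "nat \<Rightarrow> (nat \<Rightarrow> int) \<Rightarrow> bool" where
  "positive_grading n W \<longleftrightarrow> (\<forall>i\<in>{1..n}. 0 < W i)"

definition W_homogeneous :: "(nat \<Rightarrow> int) \<Rightarrow> 'k::comm_ring_1 mpoly \<Rightarrow> bool" where
  "W_homogeneous W p \<longleftrightarrow> (\<exists>d. \<forall>t\<in>Supp p. wdeg W t = d)"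

definition std_component :: "int \<Rightarrow> 'k::comm_ring_1 mpoly \<Rightarrow> 'k mpoly" where
  "std_component d p =
    (\<Sum>t\<in>{t\<in>Supp p. wdeg (\<lambda>_. 1) t = d}. Poly_Mapping.single t (Poly_Mapping.lookup p t))"

definition Lin :: "'k::comm_ring_1 mpoly \<Rightarrow> 'k mpoly" where
  "Lin p = std_component 1 p"

definition Lin_space :: "'k::field mpoly set \<Rightarrow> 'k mpoly set" where
  "Lin_space I = kspace.span (Lin ` I)"

definition irrelevant_ideal :: "nat \<Rightarrow> 'k::comm_ring_1 mpoly set" where
  "irrelevant_ideal n = Idl\<^bsub>polyring {1..n}\<^esub> (Indet ` {1..n})"

definition basis_tuple :: "'k::field mpoly list \<Rightarrow> 'k mpoly set \<Rightarrow> bool" where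
  "basis_tuple bs U \<longleftrightarrow>
    distinct bs \<and> \<not> kspace.dependent (set bs) \<and> kspace.span (set bs) = U"

text \<open>The matrix below consists of the columns of the coefficient matrix of \<open>ls\<close> that belong
  to \<open>Z\<close>. The first argument of \<^const>\<open>vec_space.rank\<close> is the number of rows.\<close>

definition top_rank :: "nat \<Rightarrow> nat list \<Rightarrow> 'k::field mpoly set \<Rightarrow> bool" where
  "top_rank n Z L \<longleftrightarrow>
    distinct Z \<and> set Z \<subseteq> {1..n} \<and>
    (\<forall>ls. kspace.span (set ls) = L \<longrightarrow>
      vec_space.rank (length ls)
        (mat (length ls) (length Z) (\<lambda>(i, j). Poly_Mapping.lookup (ls ! i) (Indet_pp (Z ! j))))
      = length Z)"

section \<open>Re-embeddings\<close>

text \<open>The polynomial \<open>h\<close> with \<open>f = z - h\<close>.\<close>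

definition hpart :: "nat \<Rightarrow> 'k::comm_ring_1 mpoly \<Rightarrow> 'k mpoly" where
  "hpart z f = Indet z - f"

definition coherently_separating :: "nat \<Rightarrow> nat list \<Rightarrow> 'k::comm_ring_1 mpoly list \<Rightarrow> bool" where
  "coherently_separating n Z F \<longleftrightarrow>
    distinct Z \<and> set Z \<subseteq> {1..n} \<and> length F = length Z \<and>
    (\<forall>i<length Z. hpart (Z ! i) (F ! i) \<in> carrier (polyring {1..n})) \<and>
    (\<forall>i<length Z. \<forall>j<length Z. \<forall>t\<in>Supp (hpart (Z ! j) (F ! j)). \<not> pp_dvd (Indet_pp (Z ! i)) t)"

text \<open>Isomorphisms of \<open>K\<close>-algebras between \<open>K[V]/I\<close> and \<open>K[Y]/J\<close>; \<open>K\<close>-linearity of a ring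
  homomorphism is expressed by compatibility with the structure maps from \<open>K\<close>.\<close>

definition K_alg_iso ::
  "nat set \<Rightarrow> 'k::field mpoly set \<Rightarrow> nat set \<Rightarrow> 'k mpoly set \<Rightarrow> ('k mpoly set \<Rightarrow> 'k mpoly set) \<Rightarrow> bool"
  where
  "K_alg_iso V I Y J \<Phi> \<longleftrightarrow>
    \<Phi> \<in> ring_iso (polyring V Quot I) (polyring Y Quot J) \<and>
    (\<forall>c. \<Phi> (I +>\<^bsub>polyring V\<^esub> Const c) = J +>\<^bsub>polyring Y\<^esub> Const c)"

definition separating_reembedding ::
  "nat \<Rightarrow> 'k::field mpoly set \<Rightarrow> nat list \<Rightarrow> 'k mpoly list \<Rightarrow> ('k mpoly set \<Rightarrow> 'k mpoly set) \<Rightarrow> bool"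
  where
  "separating_reembedding n I Z F \<Phi> \<longleftrightarrow>
    (let P = polyring {1..n}; Y = {1..n} - set Z; Q = polyring Y; J = I \<inter> carrier Q in
      K_alg_iso {1..n} I Y J \<Phi> \<and>
      (\<forall>i<length Z. \<Phi> (I +>\<^bsub>P\<^esub> Indet (Z ! i)) = J +>\<^bsub>Q\<^esub> hpart (Z ! i) (F ! i)) \<and>
      (\<forall>j\<in>Y. \<Phi> (I +>\<^bsub>P\<^esub> Indet j) = J +>\<^bsub>Q\<^esub> Indet j))"

definition optimal_reembedding ::
  "nat \<Rightarrow> 'k::field mpoly set \<Rightarrow> nat set \<Rightarrow> 'k mpoly set \<Rightarrow> ('k mpoly set \<Rightarrow> 'k mpoly set) \<Rightarrow> bool"
  where
  "optimal_reembedding n I Y J \<Phi> \<longleftrightarrow>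
    finite Y \<and> ideal J (polyring Y) \<and> K_alg_iso {1..n} I Y J \<Phi> \<and>
    (\<forall>Y' J' \<Psi>. finite Y' \<and> ideal J' (polyring Y') \<and> K_alg_iso {1..n} I Y' J' \<Psi>
      \<longrightarrow> card Y \<le> card Y')"

section \<open>The steps of the procedure\<close>

definition step1 :: "'k::field mpoly set \<Rightarrow> 'k mpoly list \<Rightarrow> 'k mpoly list \<Rightarrow> bool" where
  "step1 I G fs \<longleftrightarrow>
    subseq fs G \<and> length fs = kspace.dim (Lin_space I) \<and> basis_tuple (map Lin fs) (Lin_space I)"

text \<open>The tuples are indexed simultaneously: \<open>fs'\<close> is the re-indexed tuple \<open>fs\<close> in which the
  indices match those of \<open>Z\<close>.\<close>

definition step2 ::
  "nat \<Rightarrow> (nat \<Rightarrow> int) \<Rightarrow> 'k::field mpoly set \<Rightarrow> 'k mpoly list \<Rightarrow> 'k mpoly list \<Rightarrow> nat list \<Rightarrow> bool"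
  where
  "step2 n W I fs fs' Z \<longleftrightarrow>
    mset fs' = mset fs \<and> length Z = length fs \<and>
    top_rank n Z (Lin_space I) \<and>
    (\<forall>i<length Z. Indet_pp (Z ! i) \<in> Supp (Lin (fs' ! i))) \<and>
    sorted (map (\<lambda>z. wdeg W (Indet_pp z)) Z)"

definition step3 ::
  "nat \<Rightarrow> (nat \<Rightarrow> int) \<Rightarrow> 'k::field mpoly list \<Rightarrow> nat list \<Rightarrow> 'k mpoly list \<Rightarrow> bool"
  where
  "step3 n W fs' Z F \<longleftrightarrow>
    length F = length Z \<and>
    (\<forall>i<length Z.
      W_homogeneous W (F ! i) \<and> F ! i \<in> kspace.span (set fs') \<and>
      hpart (Z ! i) (F ! i) \<in> carrier (polyring {1..n}) \<and>
      Lin (hpart (Z ! i) (F ! i)) \<in> carrier (polyring ({1..n} - set Z)))"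

definition substitute_at :: "nat list \<Rightarrow> nat \<times> nat \<Rightarrow> 'k::field mpoly list \<Rightarrow> 'k mpoly list" where
  "substitute_at Z = (\<lambda>(i, j) F. F[j := subst_indet (Z ! i) (hpart (Z ! i) (F ! i)) (F ! j)])"

definition step4 :: "nat list \<Rightarrow> 'k::field mpoly list \<Rightarrow> 'k mpoly list" where
  "step4 Z F =
    fold (substitute_at Z) [(i, j). i \<leftarrow> [0..<length Z], j \<leftarrow> [Suc i..<length Z]] F"

end

theory Submission
  imports Defs
begin

text \<open>Since all \<open>g \<in> G\<close> have no constant term, the Leibniz rule gives that \<open>Lin(I)\<close> is spanned
  by \<open>Lin(G)\<close>. The coefficient matrix of a basis of \<open>Lin(I)\<close> at the pivot columns is invertible, so
  the Leibniz expansion of its determinant yields the matching in step (2) and its inverse the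
  interreduction in step (3). By positivity of the grading, an indeterminate \<open>z\<^sub>j\<close> in \<open>h\<^sub>i\<close> has
  degree less than \<open>z\<^sub>i\<close>; hence the substitutions successively remove all of \<open>Z\<close> from the \<open>h\<^sub>i\<close>.
  The substitution \<open>z\<^sub>i \<mapsto> h\<^sub>i\<close> is the identity modulo \<open>I\<close>, which gives the re-embedding. For optimality,
  suppose that \<open>P/I\<close> is generated by the residue classes of \<open>p\<^sub>1,\<dots>,p\<^sub>m\<close>. Then
  \<open>x\<^sub>i - q\<^sub>i(p\<^sub>1,\<dots>,p\<^sub>m) \<in> I\<close> for suitable \<open>q\<^sub>i\<close>; taking linear parts, the \<open>x\<^sub>i\<close> lie in the span
  of \<open>Lin(I)\<close> and \<open>Lin(p\<^sub>1),\<dots>,Lin(p\<^sub>m)\<close>, so that \<open>n \<le> s + m\<close>.\<close>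

section \<open>Polynomials\<close>

lemma Indet_pp_inject [simp]: "Indet_pp i = Indet_pp j \<longleftrightarrow> i = j"
  unfolding Indet_pp_def by (metis keys_single singleton_inject zero_neq_one)

lemma keys_Indet_pp [simp]: "Poly_Mapping.keys (Indet_pp i) = {i}"
  by (simp add: Indet_pp_def)

lemma Indet_pp_nonzero [simp]: "Indet_pp i \<noteq> 0" "0 \<noteq> Indet_pp i"
  using keys_Indet_pp[of i] by (auto simp del: keys_Indet_pp)

lemma lookup_Indet_pp [simp]: "Poly_Mapping.lookup (Indet_pp i) j = (if i = j then 1 else 0)"
  by (simp add: Indet_pp_def lookup_single)

lemma lookup_Indet:
  "Poly_Mapping.lookup (Indet i :: 'k::comm_ring_1 mpoly) t = (if t = Indet_pp i then 1 else 0)"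
  by (simp add: Indet_def lookup_single when_def eq_commute)

lemma indets_single_subset: "indets (Poly_Mapping.single t c) \<subseteq> Poly_Mapping.keys t"
  by (auto simp: indets_def Supp_def split: if_splits)

lemma indets_Const [simp]: "indets (Const c) = {}"
  using indets_single_subset[of 0 c] by (simp add: Const_def)

lemma indets_Indet [simp]: "indets (Indet i :: 'k::comm_ring_1 mpoly) = {i}"
  by (simp add: Indet_def indets_def Supp_def)

lemma indets_diff: "indets (p - q) \<subseteq> indets p \<union> indets q"
  using indets_add[of p "- q"] by (simp add: indets_uminus)

lemma indets_sum: "indets (sum f A) \<subseteq> (\<Union>a\<in>A. indets (f a))"
proof (induction A rule: infinite_finite_induct)
  case (insert a A)
  then show ?case using indets_add[of "f a" "sum f A"] by auto
qed (simp_all add: indets_zero)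

lemma lookup_eq_0_if_not_indet:
  "z \<notin> indets p \<Longrightarrow> z \<in> Poly_Mapping.keys t \<Longrightarrow> Poly_Mapping.lookup p t = 0"
  unfolding indets_def Supp_def by (metis UN_I in_keys_iff)

lemma Const_0 [simp]: "Const 0 = 0" and Const_1 [simp]: "Const 1 = 1"
  by (simp_all add: Const_def)

lemma single_conv_Const_times:
  "Poly_Mapping.single t c = Const c * Poly_Mapping.single t (1::'k::comm_ring_1)"
  by (simp add: Const_def mult_single)

lemma lookup_cscale [simp]: "Poly_Mapping.lookup (cscale c p) t = c * Poly_Mapping.lookup p t"
  unfolding cscale_def Const_def mult_map_scale_conv_mult[symmetric]
  by (simp add: map.rep_eq when_def)

lemma indets_cscale: "indets (cscale c p) \<subseteq> indets p"
  using indets_mult[of "Const c" p] by (simp add: cscale_def)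

section \<open>Monomial decomposition and induction principles\<close>

lemma sum_single_lookup:
  "(\<Sum>t\<in>Supp p. Poly_Mapping.single t (Poly_Mapping.lookup p t)) = p"
proof (rule poly_mapping_eqI)
  fix t
  have "Poly_Mapping.lookup (\<Sum>t\<in>Supp p. Poly_Mapping.single t (Poly_Mapping.lookup p t)) t =
    (\<Sum>u\<in>Supp p. if u = t then Poly_Mapping.lookup p t else 0)"
    unfolding lookup_sum by (intro sum.cong) (auto simp: lookup_single)
  also have "\<dots> = Poly_Mapping.lookup p t"
    by (simp add: Supp_def in_keys_iff)
  finally show "Poly_Mapping.lookup
    (\<Sum>t\<in>Supp p. Poly_Mapping.single t (Poly_Mapping.lookup p t)) t = Poly_Mapping.lookup p t" .
qed

text \<open>Every polynomial is a finite sum of monomials; identities additive in each factor, such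
  as \<open>subst_mult\<close> and \<open>Lin_mult\<close>, thus reduce to monomials.\<close>

lemma mpoly_induct [case_names monomial add]:
  fixes p :: "'k::comm_ring_1 mpoly"
  assumes "\<And>t c. Q (Poly_Mapping.single t c)" and "\<And>p q. Q p \<Longrightarrow> Q q \<Longrightarrow> Q (p + q)"
  shows "Q p"
proof -
  have "Q (\<Sum>t\<in>A. Poly_Mapping.single t (Poly_Mapping.lookup p t))" if "finite A" for A
    using that
  proof (induction A)
    case empty
    then show ?case using assms(1)[of 0 0] by simp
  qed (simp add: assms)
  from this[of "Supp p"] show ?thesis
    by (simp add: sum_single_lookup) (simp add: Supp_def)
qed

lemma single_pp_conv_prod:
  "Poly_Mapping.single t (1::'k::comm_ring_1) =
    (\<Prod>i\<in>Poly_Mapping.keys t. Indet i ^ Poly_Mapping.lookup t i)"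
proof -
  have pow: "Indet i ^ k = Poly_Mapping.single (Poly_Mapping.single i k) (1::'k)" for i k
    by (induction k) (simp_all add: Indet_def Indet_pp_def mult_single flip: single_add)
  have "(\<Prod>i\<in>A. Indet i ^ Poly_Mapping.lookup t i) =
    Poly_Mapping.single (\<Sum>i\<in>A. Poly_Mapping.single i (Poly_Mapping.lookup t i)) (1::'k)"
    if "finite A" for A
    using that
  proof (induction A)
    case (insert i A)
    then show ?case by (simp add: pow mult_single)
  qed simp
  moreover have "(\<Sum>i\<in>Poly_Mapping.keys t. Poly_Mapping.single i (Poly_Mapping.lookup t i)) = t"
    by (rule poly_mapping_eqI) (simp add: lookup_sum lookup_single when_def in_keys_iff)
  ultimately show ?thesis by simp
qed

text \<open>The indeterminates in \<open>V\<close> generate \<open>K[V]\<close> as a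
  \<open>K\<close>-algebra. The induction steps also provide \<open>indets p \<subseteq> V\<close>,
  on which arguments about ideals and cosets rely.\<close>

lemma polyring_induct [consumes 1, case_names Const Indet add mult]:
  fixes p :: "'k::comm_ring_1 mpoly"
  assumes p: "indets p \<subseteq> V"
    and C: "\<And>c. Q (Const c)" and X: "\<And>i. i \<in> V \<Longrightarrow> Q (Indet i)"
    and A: "\<And>p q. indets p \<subseteq> V \<Longrightarrow> indets q \<subseteq> V \<Longrightarrow> Q p \<Longrightarrow> Q q \<Longrightarrow> Q (p + q)"
    and M: "\<And>p q. indets p \<subseteq> V \<Longrightarrow> indets q \<subseteq> V \<Longrightarrow> Q p \<Longrightarrow> Q q \<Longrightarrow> Q (p * q)"
  shows "Q p"
proof -
  define R where "R q \<longleftrightarrow> indets q \<subseteq> V \<and> Q q" for q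
  have RC: "R (Const c)" for c by (simp add: R_def C)
  have RX: "R (Indet i)" if "i \<in> V" for i using that by (simp add: R_def X)
  have RA: "R (p + q)" if "R p" "R q" for p q
    using that indets_add[of p q] A[of p q] unfolding R_def by blast
  have RM: "R (p * q)" if "R p" "R q" for p q
    using that indets_mult[of p q] M[of p q] unfolding R_def by blast
  have Rp: "R (p ^ k)" if "R p" for p k
    using that RC[of 1] by (induction k) (auto intro: RM)
  have mon: "R (Poly_Mapping.single t c)" if t: "Poly_Mapping.keys t \<subseteq> V" for t c
  proof -
    have "R (\<Prod>i\<in>B. Indet i ^ Poly_Mapping.lookup t i)" if "finite B" "B \<subseteq> V" for B
      using that
    proof (induction B)
      case empty
      then show ?case using RC[of 1] by simp
    qed (auto intro: RM RX Rp)
    from RM[OF RC[of c] this[OF _ t]] show ?thesis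
      by (subst single_conv_Const_times) (simp add: single_pp_conv_prod)
  qed
  have "R (\<Sum>t\<in>B. Poly_Mapping.single t (Poly_Mapping.lookup p t))"
    if "finite B" "B \<subseteq> Supp p" for B
    using that
  proof (induction B)
    case empty
    then show ?case using RC[of 0] by simp
  next
    case (insert t B)
    then have "Poly_Mapping.keys t \<subseteq> V" using p by (auto simp: indets_def)
    with insert show ?case by (auto intro: RA mon)
  qed
  from this[of "Supp p"] show ?thesis
    by (simp add: sum_single_lookup R_def) (simp add: Supp_def)
qed

subsection \<open>Substitution\<close>

lemma subst_alt:
  assumes "finite A" "Supp p \<subseteq> A"
  shows "subst \<sigma> p = (\<Sum>t\<in>A. Const (Poly_Mapping.lookup p t) *
      (\<Prod>i\<in>Poly_Mapping.keys t. \<sigma> i ^ Poly_Mapping.lookup t i))"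
  unfolding subst_def using assms
  by (intro sum.mono_neutral_left) (auto simp: Supp_def in_keys_iff)

lemma Const_add: "Const (a + b) = Const a + Const b"
  and Const_mult: "Const (a * b) = Const a * Const b"
  by (simp_all add: Const_def single_add mult_single)

lemma subst_add: "subst \<sigma> (p + q) = subst \<sigma> p + subst \<sigma> q"
proof -
  have *: "finite (Supp p \<union> Supp q)" "Supp (p + q) \<subseteq> Supp p \<union> Supp q"
    using Poly_Mapping.keys_add[of p q] by (auto simp: Supp_def)
  show ?thesis
    by (simp add: subst_alt[OF *] subst_alt[OF *(1), of p] subst_alt[OF *(1), of q]
        lookup_add Const_add distrib_right sum.distrib)
qed

lemma subst_single:
  "subst \<sigma> (Poly_Mapping.single t c) =
    Const c * (\<Prod>i\<in>Poly_Mapping.keys t. \<sigma> i ^ Poly_Mapping.lookup t i)"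
  by (subst subst_alt[of "{t}"]) (auto simp: Supp_def split: if_splits)

lemma subst_Const [simp]: "subst \<sigma> (Const c) = Const c"
  by (simp add: Const_def subst_single)

lemma subst_Indet [simp]: "subst \<sigma> (Indet i) = \<sigma> i"
  by (simp add: Indet_def subst_single)

lemma subst_mult: "subst \<sigma> (p * q) = subst \<sigma> p * subst \<sigma> q"
proof (induction p rule: mpoly_induct)
  case (monomial s a)
  show ?case
  proof (induction q rule: mpoly_induct)
    case (monomial t b)
    \<comment> \<open>Exponents outside the keys of \<open>u\<close> are zero, so all three products
      below may run over one common index set.\<close>
    have *: "(\<Prod>i\<in>Poly_Mapping.keys u. \<sigma> i ^ Poly_Mapping.lookup u i) =
      (\<Prod>i\<in>Poly_Mapping.keys s \<union> Poly_Mapping.keys t. \<sigma> i ^ Poly_Mapping.lookup u i)"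
      if "Poly_Mapping.keys u \<subseteq> Poly_Mapping.keys s \<union> Poly_Mapping.keys t" for u
      using that by (intro prod.mono_neutral_left) (auto simp: in_keys_iff)
    have "(\<Prod>i\<in>Poly_Mapping.keys (s + t). \<sigma> i ^ Poly_Mapping.lookup (s + t) i) =
      (\<Prod>i\<in>Poly_Mapping.keys s. \<sigma> i ^ Poly_Mapping.lookup s i) *
      (\<Prod>i\<in>Poly_Mapping.keys t. \<sigma> i ^ Poly_Mapping.lookup t i)"
      using *[of s] *[of t] *[OF Poly_Mapping.keys_add]
      by (simp add: lookup_add power_add prod.distrib)
    then show ?case by (simp add: mult_single subst_single Const_mult ac_simps)
  qed (simp add: subst_add distrib_left)
qed (simp add: subst_add distrib_right)

lemma subst_uminus: "subst \<sigma> (- p) = - subst \<sigma> p"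
  by (metis add_eq_0_iff subst_Const subst_add Const_0 add.right_inverse)

lemma subst_diff: "subst \<sigma> (p - q) = subst \<sigma> p - subst \<sigma> q"
  using subst_add[of \<sigma> p "- q"] by (simp add: subst_uminus)

lemma subst_id:
  assumes "\<And>i. i \<in> indets p \<Longrightarrow> \<sigma> i = Indet i"
  shows "subst \<sigma> p = p"
  by (rule polyring_induct[of p "indets p"]) (auto simp: assms subst_add subst_mult)

lemma indets_subst: "indets (subst \<sigma> p) \<subseteq> (\<Union>i\<in>indets p. indets (\<sigma> i))"
proof -
  have "indets (subst \<sigma> q) \<subseteq> (\<Union>i\<in>V. indets (\<sigma> i))" if "indets q \<subseteq> V" for q V
    using that
  proof (induction rule: polyring_induct)
    case (add p q)
    then show ?case using indets_add[of "subst \<sigma> p" "subst \<sigma> q"] by (auto simp: subst_add)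
  next
    case (mult p q)
    then show ?case using indets_mult[of "subst \<sigma> p" "subst \<sigma> q"] by (auto simp: subst_mult)
  qed auto
  then show ?thesis by blast
qed

lemma indets_subst_indet: "indets (subst_indet z h p) \<subseteq> (indets p - {z}) \<union> indets h"
  using indets_subst[of "Indet(z := h)" p] unfolding subst_indet_def
  by (force split: if_splits)

subsection \<open>Degrees and linear parts\<close>

lemma wdeg_alt:
  assumes "finite A" "Poly_Mapping.keys t \<subseteq> A"
  shows "wdeg W t = (\<Sum>i\<in>A. W i * int (Poly_Mapping.lookup t i))"
  unfolding wdeg_def using assms by (intro sum.mono_neutral_left) (auto simp: in_keys_iff)

lemma wdeg_add: "wdeg W (s + t) = wdeg W s + wdeg W t"
proof -
  have *: "finite (Poly_Mapping.keys s \<union> Poly_Mapping.keys t)" by simp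
  show ?thesis using Poly_Mapping.keys_add[of s t]
    by (simp add: wdeg_alt[OF *, of s] wdeg_alt[OF *, of t] wdeg_alt[OF *, of "s + t"]
        lookup_add distrib_left sum.distrib)
qed

lemma wdeg_0 [simp]: "wdeg W 0 = 0" and wdeg_Indet_pp [simp]: "wdeg W (Indet_pp i) = W i"
  by (simp_all add: wdeg_def)

lemma wdeg_pos:
  assumes "\<And>i. i \<in> Poly_Mapping.keys t \<Longrightarrow> 0 < W i" "t \<noteq> 0"
  shows "0 < wdeg W t"
  unfolding wdeg_def using assms by (intro sum_pos) (auto simp: in_keys_iff)

lemma Indet_pp_dvd:
  assumes "z \<in> Poly_Mapping.keys t"
  obtains u where "t = Indet_pp z + u"
proof
  show "t = Indet_pp z + (t - Indet_pp z)"
    using assms by (intro poly_mapping_eqI) (auto simp: lookup_add lookup_minus in_keys_iff)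
qed

lemma pp_dvd_Indet_pp: "pp_dvd (Indet_pp z) t \<longleftrightarrow> z \<in> Poly_Mapping.keys t"
proof
  assume "pp_dvd (Indet_pp z) t"
  then show "z \<in> Poly_Mapping.keys t" by (auto simp: pp_dvd_def in_keys_iff lookup_add)
next
  assume "z \<in> Poly_Mapping.keys t"
  then obtain u where "t = Indet_pp z + u" by (rule Indet_pp_dvd)
  then show "pp_dvd (Indet_pp z) t" unfolding pp_dvd_def by blast
qed

text \<open>Some indeterminate divides \<open>t\<close>, and a nontrivial cofactor would raise the
  degree above one.\<close>

lemma total_deg_eq_1_iff: "wdeg (\<lambda>_. 1) t = 1 \<longleftrightarrow> (\<exists>i. t = Indet_pp i)"
proof
  assume t: "wdeg (\<lambda>_. 1) t = 1"
  then have "t \<noteq> 0" by auto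
  then obtain z where "z \<in> Poly_Mapping.keys t" by (metis all_not_in_conv keys_eq_empty)
  then obtain u where u: "t = Indet_pp z + u" by (rule Indet_pp_dvd)
  with t have "u = 0" using wdeg_pos[of u "\<lambda>_. 1"] by (auto simp: wdeg_add)
  with u show "\<exists>i. t = Indet_pp i" by auto
qed auto

lemma lookup_Lin:
  "Poly_Mapping.lookup (Lin p) t = (if wdeg (\<lambda>_. 1) t = 1 then Poly_Mapping.lookup p t else 0)"
proof -
  let ?T = "{u \<in> Supp p. wdeg (\<lambda>_. 1) u = 1}"
  have "Poly_Mapping.lookup (Lin p) t = (\<Sum>u\<in>?T. if u = t then Poly_Mapping.lookup p t else 0)"
    unfolding Lin_def std_component_def lookup_sum
    by (intro sum.cong) (auto simp: lookup_single)
  also have "\<dots> = (if t \<in> ?T then Poly_Mapping.lookup p t else 0)"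
    by (simp add: Supp_def)
  finally show ?thesis by (auto simp: Supp_def in_keys_iff)
qed

lemma lookup_Lin_Indet_pp [simp]:
  "Poly_Mapping.lookup (Lin p) (Indet_pp i) = Poly_Mapping.lookup p (Indet_pp i)"
  by (simp add: lookup_Lin)

lemma Lin_add: "Lin (p + q) = Lin p + Lin q"
  and Lin_diff: "Lin (p - q) = Lin p - Lin q"
  and Lin_0 [simp]: "Lin 0 = 0"
  by (rule poly_mapping_eqI; simp add: lookup_Lin lookup_add lookup_minus)+

lemma Lin_Const [simp]: "Lin (Const c) = 0"
  by (rule poly_mapping_eqI) (auto simp: lookup_Lin Const_def lookup_single when_def)

lemma Lin_Indet [simp]: "Lin (Indet i) = Indet i"
  by (rule poly_mapping_eqI) (auto simp: lookup_Lin lookup_Indet)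

text \<open>Exponents are natural numbers, so a product of two terms is trivial only if both factors
  are.\<close>

lemma lookup_mult_0:
  "Poly_Mapping.lookup (p * q :: 'k::comm_ring_1 mpoly) 0 =
    Poly_Mapping.lookup p 0 * Poly_Mapping.lookup q 0"
proof (induction p rule: mpoly_induct)
  case (monomial s a)
  show ?case
  proof (induction q rule: mpoly_induct)
    case (monomial t b)
    have "s + t = 0 \<longleftrightarrow> s = 0 \<and> t = 0"
      by (metis add_is_0 lookup_add lookup_zero poly_mapping_eqI)
    then show ?case by (auto simp: mult_single lookup_single when_def)
  qed (simp add: lookup_add distrib_left)
qed (simp add: lookup_add distrib_right)

text \<open>Leibniz rule at the origin: a degree-one term of a product arises only as a constant
  times a degree-one term.\<close>

lemma Lin_mult:
  "Lin (p * q) = cscale (Poly_Mapping.lookup p 0) (Lin q) + cscale (Poly_Mapping.lookup q 0) (Lin p)"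
proof (induction p rule: mpoly_induct)
  case (monomial s a)
  show ?case
  proof (induction q rule: mpoly_induct)
    case (monomial t b)
    have Lin_single: "Lin (Poly_Mapping.single u c) =
        (if wdeg (\<lambda>_. 1) u = 1 then Poly_Mapping.single u c else 0)" for u and c :: 'a
      by (rule poly_mapping_eqI) (auto simp: lookup_Lin lookup_single when_def)
    have pos: "0 < wdeg (\<lambda>_. 1) u" if "u \<noteq> 0" for u using that by (intro wdeg_pos) auto
    show ?case
      using pos[of s] pos[of t]
      by (cases "s = 0"; cases "t = 0")
        (auto simp: mult_single Lin_single wdeg_add lookup_single when_def cscale_def Const_def
          single_add mult.commute)
  qed (simp add: Lin_add lookup_add cscale_def Const_add algebra_simps)
qed (simp add: Lin_add lookup_add cscale_def Const_add algebra_simps)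

section \<open>Homogeneity in a prescribed weighted degree\<close>

text \<open>The degree is a parameter because sums of homogeneous polynomials stay homogeneous only
  within one degree; the zero polynomial has every degree.\<close>

definition of_wdeg :: "(nat \<Rightarrow> int) \<Rightarrow> int \<Rightarrow> 'k::comm_ring_1 mpoly \<Rightarrow> bool" where
  "of_wdeg W d p \<longleftrightarrow> (\<forall>t\<in>Supp p. wdeg W t = d)"

lemma of_wdeg_Indet: "of_wdeg W (W i) (Indet i)"
  by (simp add: of_wdeg_def Supp_def Indet_def)

lemma of_wdeg_add: "of_wdeg W d p \<Longrightarrow> of_wdeg W d q \<Longrightarrow> of_wdeg W d (p + q)"
  using Poly_Mapping.keys_add[of p q] by (auto simp: of_wdeg_def Supp_def)

lemma of_wdeg_uminus: "of_wdeg W d p \<Longrightarrow> of_wdeg W d (- p)"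
  by (auto simp: of_wdeg_def Supp_def keys_def)

lemma of_wdeg_diff: "of_wdeg W d p \<Longrightarrow> of_wdeg W d q \<Longrightarrow> of_wdeg W d (p - q)"
  using of_wdeg_add[of W d p "- q"] of_wdeg_uminus[of W d q] by simp

lemma of_wdeg_0: "of_wdeg W d 0"
  by (simp add: of_wdeg_def Supp_def)

lemma of_wdeg_cscale: "of_wdeg W d p \<Longrightarrow> of_wdeg W d (cscale c p)"
  by (auto simp: of_wdeg_def Supp_def in_keys_iff)

lemma of_wdeg_sum: "(\<And>a. a \<in> A \<Longrightarrow> of_wdeg W d (f a)) \<Longrightarrow> of_wdeg W d (sum f A)"
  by (induction A rule: infinite_finite_induct) (auto intro: of_wdeg_add of_wdeg_0)

lemma of_wdeg_mult: "of_wdeg W d p \<Longrightarrow> of_wdeg W e q \<Longrightarrow> of_wdeg W (d + e) (p * q)"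
  using keys_mult[of p q] by (fastforce simp: of_wdeg_def Supp_def wdeg_add)

lemma of_wdeg_power: "of_wdeg W d p \<Longrightarrow> of_wdeg W (d * int k) (p ^ k)"
proof (induction k)
  case 0
  then show ?case by (simp add: of_wdeg_def Supp_def)
next
  case (Suc k)
  then show ?case using of_wdeg_mult[of W d p "d * int k" "p ^ k"] by (simp add: algebra_simps)
qed

lemma of_wdeg_prod:
  assumes "finite A" "\<And>i. i \<in> A \<Longrightarrow> of_wdeg W (d i) (f i)"
  shows "of_wdeg W (sum d A) (prod f A)"
  using assms
proof (induction A)
  case empty
  then show ?case by (simp add: of_wdeg_def Supp_def)
qed (auto intro: of_wdeg_mult)

text \<open>Each factor \<open>\<sigma> i\<close> contributes the weight of the indeterminate that
  it replaces, so every term keeps its weight.\<close>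

lemma of_wdeg_subst:
  assumes "of_wdeg W d p" and \<sigma>: "\<And>i. of_wdeg W (W i) (\<sigma> i)"
  shows "of_wdeg W d (subst \<sigma> p)"
  unfolding subst_def
proof (rule of_wdeg_sum)
  fix t assume "t \<in> Supp p"
  with assms(1) have t: "wdeg W t = d" by (simp add: of_wdeg_def)
  show "of_wdeg W d (Const (Poly_Mapping.lookup p t) *
      (\<Prod>i\<in>Poly_Mapping.keys t. \<sigma> i ^ Poly_Mapping.lookup t i))"
    unfolding cscale_def[symmetric] t[symmetric] wdeg_def
    by (intro of_wdeg_cscale of_wdeg_prod of_wdeg_power \<sigma>) simp
qed

section \<open>Linear algebra\<close>

text \<open>Echelon data phrased through the subspace \<open>U\<close> alone, so that it applies to
  every list spanning \<open>U\<close>, as the quantifier over \<open>ls\<close> in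
  \<open>top_rank\<close> demands.\<close>

definition dual_family :: "'k::field mpoly set \<Rightarrow> nat set \<Rightarrow> (nat \<Rightarrow> 'k mpoly) \<Rightarrow> bool" where
  "dual_family U Z d \<longleftrightarrow> (\<forall>z\<in>Z. d z \<in> U \<and>
    (\<forall>z'\<in>Z. Poly_Mapping.lookup (d z) (Indet_pp z') = (if z' = z then 1 else 0)))"

text \<open>Gaussian elimination: \<open>Z\<close> is the set of pivots and \<open>d\<close> the reduced echelon basis. The last
  clause is only needed for the induction.\<close>

lemma echelon_basis:
  fixes B :: "'k::field mpoly set"
  assumes "finite B" "\<not> kspace.dependent B"
    and "\<And>l t. l \<in> B \<Longrightarrow> t \<notin> Indet_pp ` X \<Longrightarrow> Poly_Mapping.lookup l t = 0"
  obtains Z d where "Z \<subseteq> X" "finite Z" "card Z = card B" "dual_family (kspace.span B) Z d"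
    "\<And>l. l \<in> kspace.span B \<Longrightarrow> (\<And>z. z \<in> Z \<Longrightarrow> Poly_Mapping.lookup l (Indet_pp z) = 0) \<Longrightarrow> l = 0"
  using assms
proof (induction B arbitrary: thesis)
  case empty
  show ?case by (rule empty.prems(1)[of "{}"]) (simp_all add: dual_family_def)
next
  case (insert b B)
  have indep: "\<not> kspace.dependent B" and b: "b \<notin> kspace.span B"
    using insert.prems(2) insert.hyps(2) by (simp_all add: kspace.independent_insert)
  obtain Z d where Z: "Z \<subseteq> X" "finite Z" "card Z = card B" and "dual_family (kspace.span B) Z d"
    and inj: "\<And>l. l \<in> kspace.span B \<Longrightarrow>
      (\<And>z. z \<in> Z \<Longrightarrow> Poly_Mapping.lookup l (Indet_pp z) = 0) \<Longrightarrow> l = 0"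
    by (rule insert.IH[OF _ indep insert.prems(3)]) auto
  then have d: "d z \<in> kspace.span B"
    "z' \<in> Z \<Longrightarrow> Poly_Mapping.lookup (d z) (Indet_pp z') = (if z' = z then 1 else 0)"
    if "z \<in> Z" for z z'
    using that by (auto simp: dual_family_def)
  have sub: "kspace.span B \<subseteq> kspace.span (insert b B)"
    by (intro kspace.span_mono) auto
  \<comment> \<open>\<open>c\<close> agrees with \<open>b\<close> at the old pivots, so that
    \<open>b - c\<close> vanishes there.\<close>
  define c where "c = (\<Sum>z\<in>Z. cscale (Poly_Mapping.lookup b (Indet_pp z)) (d z))"
  have c: "c \<in> kspace.span B"
    unfolding c_def using d by (auto intro: kspace.span_sum kspace.span_scale)
  have bc_span: "b - c \<in> kspace.span (insert b B)"
    using c sub by (intro kspace.span_diff[OF kspace.span_base]) auto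
  have bc_Z: "Poly_Mapping.lookup (b - c) (Indet_pp z) = 0" if "z \<in> Z" for z
  proof -
    have "Poly_Mapping.lookup c (Indet_pp z) =
        (\<Sum>x\<in>Z. if x = z then Poly_Mapping.lookup b (Indet_pp z) else 0)"
      unfolding c_def lookup_sum using that by (intro sum.cong) (auto simp: d)
    with that Z(2) show ?thesis by (simp add: lookup_minus)
  qed
  have lin: "Poly_Mapping.lookup l t = 0" if "l \<in> kspace.span (insert b B)" "t \<notin> Indet_pp ` X" for l t
    using that
  proof (induction rule: kspace.span_induct_alt)
    case (step c x y)
    with insert.prems(3)[of x t] show ?case by (auto simp: lookup_add)
  qed simp
  \<comment> \<open>The new pivot: \<open>b - c\<close> is nonzero because \<open>b\<close> lies
    outside the span of \<open>B\<close>, and all its terms are indeterminates from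
    \<open>X\<close>.\<close>
  obtain z0 where z0: "z0 \<in> X" "Poly_Mapping.lookup (b - c) (Indet_pp z0) \<noteq> 0"
  proof (rule ccontr)
    assume "\<not> thesis"
    with that have "Poly_Mapping.lookup (b - c) (Indet_pp z) = 0" if "z \<in> X" for z
      using that by blast
    then have "b - c = 0"
      using lin[OF bc_span] by (intro poly_mapping_eqI) (metis imageE lookup_zero)
    with b c show False by simp
  qed
  have z0Z: "z0 \<notin> Z" using z0(2) bc_Z by blast
  define b' where "b' = cscale (inverse (Poly_Mapping.lookup (b - c) (Indet_pp z0))) (b - c)"
  have b': "b' \<in> kspace.span (insert b B)" "Poly_Mapping.lookup b' (Indet_pp z0) = 1"
    "\<And>z. z \<in> Z \<Longrightarrow> Poly_Mapping.lookup b' (Indet_pp z) = 0"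
    using z0(2) bc_Z by (auto simp: b'_def intro: kspace.span_scale[OF bc_span])
  \<comment> \<open>This clears the new pivot column in the old echelon elements. As
    \<open>b'\<close> vanishes at the old pivots, the old pivot columns are unchanged.\<close>
  define d' where "d' z = (if z = z0 then b' else
    d z - cscale (Poly_Mapping.lookup (d z) (Indet_pp z0)) b')" for z
  have d'_span: "d' z \<in> kspace.span (insert b B)" if "z \<in> insert z0 Z" for z
    using that d sub b'(1) by (auto simp: d'_def intro!: kspace.span_diff kspace.span_scale)
  have d'_coef: "Poly_Mapping.lookup (d' z) (Indet_pp z') = (if z' = z then 1 else 0)"
    if "z \<in> insert z0 Z" "z' \<in> insert z0 Z" for z z'
    using that z0Z by (auto simp: d'_def lookup_minus b' d)
  have inj': "l = 0" if l: "l \<in> kspace.span (insert b B)"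
    and 0: "\<And>z. z \<in> insert z0 Z \<Longrightarrow> Poly_Mapping.lookup l (Indet_pp z) = 0" for l
  proof -
    obtain k where k: "l - cscale k b \<in> kspace.span B"
      using l by (auto simp: kspace.span_breakdown_eq)
    \<comment> \<open>Once the right multiple of \<open>b - c\<close> is removed, what remains of
      \<open>l\<close> lies in the old span and vanishes at the old pivots, so it is zero by
      \<open>inj\<close>; column \<open>z0\<close> then forces \<open>k = 0\<close>.\<close>
    have eq: "l - cscale k (b - c) = (l - cscale k b) + cscale k c"
      by (simp add: kspace.scale_right_diff_distrib)
    have "l - cscale k (b - c) \<in> kspace.span B"
      unfolding eq using k c by (intro kspace.span_add kspace.span_scale)
    then have "l - cscale k (b - c) = 0"
    proof (rule inj)
      fix z assume "z \<in> Z"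
      with 0[of z] bc_Z[of z]
      show "Poly_Mapping.lookup (l - cscale k (b - c)) (Indet_pp z) = 0"
        by (simp only: lookup_minus[of l] lookup_cscale) simp
    qed
    then have l_eq: "l = cscale k (b - c)" by simp
    with 0[of z0] z0(2) have "k = 0" by simp
    with l_eq show "l = 0" by simp
  qed
  show ?case
  proof (rule insert.prems(1))
    show "insert z0 Z \<subseteq> X" "finite (insert z0 Z)" "card (insert z0 Z) = card (insert b B)"
      using Z z0(1) z0Z insert.hyps by auto
    show "dual_family (kspace.span (insert b B)) (insert z0 Z) d'"
      unfolding dual_family_def using d'_span d'_coef by blast
  qed (rule inj')
qed

section \<open>Coefficient matrices and their column rank\<close>

text \<open>This is the matrix occurring in \<open>top_rank\<close>.\<close>

definition column_matrix :: "'k::field mpoly list \<Rightarrow> nat list \<Rightarrow> 'k mat" where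
  "column_matrix ls Z =
    mat (length ls) (length Z) (\<lambda>(i, j). Poly_Mapping.lookup (ls ! i) (Indet_pp (Z ! j)))"

lemma column_matrix_carrier: "column_matrix ls Z \<in> carrier_mat (length ls) (length Z)"
  by (simp add: column_matrix_def)

text \<open>A relation among the columns is satisfied by every row, hence by every element of the
  span. Evaluated at \<open>d z\<close> it isolates a single coefficient, which must vanish, so the
  columns are independent.\<close>

lemma rank_column_matrix:
  fixes ls :: "'k::field mpoly list"
  assumes dZ: "distinct Z"
    and "dual_family (kspace.span (set ls)) (set Z) d"
  shows "vec_space.rank (length ls) (column_matrix ls Z) = length Z"
proof -
  interpret vec_space "TYPE('k)" "length ls" .
  let ?A = "column_matrix ls Z"
  have d: "d z \<in> kspace.span (set ls)"
    "z' \<in> set Z \<Longrightarrow> Poly_Mapping.lookup (d z) (Indet_pp z') = (if z' = z then 1 else 0)"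
    if "z \<in> set Z" for z z'
    using assms(2) that by (auto simp: dual_family_def)
  have span0: "(\<Sum>j<length Z. Poly_Mapping.lookup l (Indet_pp (Z ! j)) * a j) = 0"
    if "\<And>i. i < length ls \<Longrightarrow>
        (\<Sum>j<length Z. Poly_Mapping.lookup (ls ! i) (Indet_pp (Z ! j)) * a j) = 0"
      and "l \<in> kspace.span (set ls)" for a l
    using that(2)
  proof (induction rule: kspace.span_induct_alt)
    case base
    then show ?case by simp
  next
    case (step c x y)
    then obtain i where "i < length ls" "x = ls ! i" by (metis in_set_conv_nth)
    with that(1) have "(\<Sum>j<length Z. Poly_Mapping.lookup x (Indet_pp (Z ! j)) * a j) = 0" by simp
    with step show ?case
      by (simp add: lookup_add distrib_right sum.distrib mult.assoc flip: sum_distrib_left)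
  qed
  have coef0: "a k = 0"
    if a: "\<And>i. i < length ls \<Longrightarrow>
        (\<Sum>j<length Z. Poly_Mapping.lookup (ls ! i) (Indet_pp (Z ! j)) * a j) = 0"
      and k: "k < length Z" for a k
  proof -
    have "0 = (\<Sum>j<length Z. Poly_Mapping.lookup (d (Z ! k)) (Indet_pp (Z ! j)) * a j)"
      using span0[OF a d(1)] k by simp
    also have "\<dots> = (\<Sum>j<length Z. if j = k then a k else 0)"
      using k dZ by (intro sum.cong) (auto simp: d(2) nth_eq_iff_index_eq)
    finally show ?thesis using k by simp
  qed
  \<comment> \<open>Linear independence is stated for the set of columns, so repetitions are
    excluded first: two equal columns would give a relation with coefficients \<open>1\<close> and
    \<open>- 1\<close>.\<close>
  have dist: "distinct (cols ?A)"
  proof (rule ccontr)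
    assume "\<not> distinct (cols ?A)"
    then obtain j k where jk: "j < length Z" "k < length Z" "j \<noteq> k" "col ?A j = col ?A k"
      by (auto simp: distinct_conv_nth column_matrix_def)
    let ?a = "\<lambda>i. if i = j then 1 else if i = k then - 1 else 0 :: 'k"
    have "(\<Sum>m<length Z. Poly_Mapping.lookup (ls ! i) (Indet_pp (Z ! m)) * ?a m) = 0"
      if i: "i < length ls" for i
    proof -
      have eq: "Poly_Mapping.lookup (ls ! i) (Indet_pp (Z ! j)) =
          Poly_Mapping.lookup (ls ! i) (Indet_pp (Z ! k))"
        using arg_cong[OF jk(4), of "\<lambda>v. v $ i"] jk i by (simp add: column_matrix_def)
      have "(\<Sum>m<length Z. Poly_Mapping.lookup (ls ! i) (Indet_pp (Z ! m)) * ?a m) =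
        (\<Sum>m<length Z. (if m = j then Poly_Mapping.lookup (ls ! i) (Indet_pp (Z ! j)) else 0) -
          (if m = k then Poly_Mapping.lookup (ls ! i) (Indet_pp (Z ! k)) else 0))"
        using jk(3) by (intro sum.cong) auto
      also have "\<dots> = 0"
        using jk(1,2) eq unfolding sum_subtractf by (subst (1 2) sum.delta) auto
      finally show ?thesis .
    qed
    from coef0[of ?a, OF this jk(1)] show False by simp
  qed
  have "lin_indpt (set (cols ?A))"
  proof
    assume "lin_dep (set (cols ?A))"
    then obtain v where v: "v \<in> carrier_vec (length Z)" "v \<noteq> 0\<^sub>v (length Z)"
      "?A *\<^sub>v v = 0\<^sub>v (length ls)"
      using lin_depE[OF column_matrix_carrier _ dist] by blast
    have "(\<Sum>j<length Z. Poly_Mapping.lookup (ls ! i) (Indet_pp (Z ! j)) * v $ j) = 0"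
      if i: "i < length ls" for i
      using arg_cong[OF v(3), of "\<lambda>v. v $ i"] i v(1)
      by (simp add: column_matrix_def scalar_prod_def atLeast0LessThan)
    from coef0[of "($) v", OF this] v(1,2) show False by (metis eq_vecI carrier_vecD index_zero_vec)
  qed
  from lin_indpt_full_rank[OF column_matrix_carrier dist this] show ?thesis .
qed

section \<open>Nonzero determinants: inverses and transversals\<close>

lemma det_column_matrix_nonzero_iff:
  fixes ls :: "'k::field mpoly list"
  assumes "length Z = length ls"
  shows "det (column_matrix ls Z) \<noteq> 0 \<longleftrightarrow>
    vec_space.rank (length ls) (column_matrix ls Z) = length Z"
proof -
  interpret vec_space "TYPE('k)" "length ls" .
  show ?thesis using det_rank_iff[of "column_matrix ls Z"] column_matrix_carrier[of ls Z] assms by simp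
qed

lemma exists_left_inverse:
  fixes A :: "'a::field mat"
  assumes A: "A \<in> carrier_mat m m" and "det A \<noteq> 0"
  shows "\<exists>b. \<forall>i<m. \<forall>k<m. (\<Sum>j<m. b i j * A $$ (j, k)) = (if i = k then 1 else 0)"
proof -
  from det_non_zero_imp_unit[OF A assms(2), of "TYPE(nat)"]
  obtain B where B: "B \<in> carrier_mat m m" "B * A = 1\<^sub>m m"
    by (auto simp: Units_def ring_mat_def)
  have "(\<Sum>j<m. B $$ (i, j) * A $$ (j, k)) = (if i = k then 1 else 0)" if "i < m" "k < m" for i k
    using arg_cong[OF B(2), of "\<lambda>M. M $$ (i, k)"] that A B(1)
    by (simp add: scalar_prod_def atLeast0LessThan)
  then show ?thesis by (intro exI[of _ "\<lambda>i j. B $$ (i, j)"]) blast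
qed

text \<open>Some summand of the Leibniz formula is nonzero. Here \<open>p\<close> sends columns to
  rows, so that it can assign to each \<open>z_i\<close> a polynomial whose linear part contains it;
  passing to the transpose gives this orientation.\<close>

lemma exists_transversal:
  fixes A :: "'a::field mat"
  assumes A: "A \<in> carrier_mat m m" and "det A \<noteq> 0"
  shows "\<exists>p. p permutes {0..<m} \<and> (\<forall>i<m. A $$ (p i, i) \<noteq> 0)"
proof -
  have "det (transpose_mat A) \<noteq> 0" using assms by (simp add: det_transpose)
  then have "(\<Sum>p\<in>{p. p permutes {0..<m}}. signof p *
      (\<Prod>i = 0..<m. transpose_mat A $$ (i, p i))) \<noteq> 0"
    by (subst (asm) det_def'[of _ m]) (rule transpose_carrier_mat[THEN iffD2, OF A])
  from sum.not_neutral_contains_not_neutral[OF this]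
  obtain p where p: "p permutes {0..<m}"
    "signof p * (\<Prod>i = 0..<m. transpose_mat A $$ (i, p i)) \<noteq> 0"
    by blast
  have "A $$ (p i, i) \<noteq> 0" if "i < m" for i
  proof -
    have "transpose_mat A $$ (i, p i) \<noteq> 0" using p(2) that by auto
    then show ?thesis using that A permutes_in_image[OF p(1), of i] by simp
  qed
  with p(1) show ?thesis by blast
qed

section \<open>Ideals of polynomial rings\<close>

lemma carrier_polyring [simp]: "p \<in> carrier (polyring V) \<longleftrightarrow> indets p \<subseteq> V"
  by (simp add: polyring_def)

lemma polyring_simps [simp]:
  "x \<otimes>\<^bsub>polyring V\<^esub> y = x * y" "\<one>\<^bsub>polyring V\<^esub> = 1"
  "\<zero>\<^bsub>polyring V\<^esub> = 0" "x \<oplus>\<^bsub>polyring V\<^esub> y = x + y"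
  by (simp_all add: polyring_def)

lemma ring_polyring: "ring (polyring V)"
  using cring_polyring by (rule cring.axioms)

lemma ideal_polyringI:
  fixes I :: "'k::comm_ring_1 mpoly set"
  assumes sub: "\<And>p. p \<in> I \<Longrightarrow> indets p \<subseteq> V" and zero: "0 \<in> I"
    and add: "\<And>p q. p \<in> I \<Longrightarrow> q \<in> I \<Longrightarrow> p + q \<in> I"
    and mult: "\<And>p q. p \<in> I \<Longrightarrow> indets q \<subseteq> V \<Longrightarrow> q * p \<in> I"
  shows "ideal I (polyring V)"
proof (rule idealI[OF ring_polyring])
  interpret R: cring "polyring V :: 'k mpoly ring" by (rule cring_polyring)
  show "subgroup I (add_monoid (polyring V))"
  proof (rule R.add.subgroupI)
    fix p assume p: "p \<in> I"
    have "- p \<in> I" using mult[OF p, of "- 1"] by (simp add: indets_uminus indets_one)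
    moreover have "\<ominus>\<^bsub>polyring V\<^esub> p = - p"
      using sub[OF p] by (intro R.minus_equality) (auto simp: indets_uminus)
    ultimately show "\<ominus>\<^bsub>polyring V\<^esub> p \<in> I" by simp
  qed (use sub zero add in auto)
qed (use mult in \<open>auto simp: mult.commute\<close>)

lemma genideal_polyring:
  assumes "\<And>p. p \<in> S \<Longrightarrow> indets p \<subseteq> V"
  shows "ideal (Idl\<^bsub>polyring V\<^esub> S) (polyring V)" and "S \<subseteq> Idl\<^bsub>polyring V\<^esub> S"
proof -
  have "S \<subseteq> carrier (polyring V)" using assms by auto
  then show "ideal (Idl\<^bsub>polyring V\<^esub> S) (polyring V)" and "S \<subseteq> Idl\<^bsub>polyring V\<^esub> S"
    by (auto intro: ring.genideal_ideal[OF ring_polyring]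
        subsetD[OF ring.genideal_self[OF ring_polyring]])
qed

context
  fixes I :: "'k::comm_ring_1 mpoly set" and V
  assumes I: "ideal I (polyring V)"
begin

lemma ideal_indets: "p \<in> I \<Longrightarrow> indets p \<subseteq> V"
  using ideal.Icarr[OF I] by auto

lemma ideal_zero: "0 \<in> I"
  using additive_subgroup.zero_closed[OF ideal.axioms(1)[OF I]] by simp

lemma ideal_add: "p \<in> I \<Longrightarrow> q \<in> I \<Longrightarrow> p + q \<in> I"
  using additive_subgroup.a_closed[OF ideal.axioms(1)[OF I]] by simp

lemma ideal_mult_left: "p \<in> I \<Longrightarrow> indets q \<subseteq> V \<Longrightarrow> q * p \<in> I"
  using ideal.I_l_closed[OF I] by simp

lemma ideal_mult_right: "p \<in> I \<Longrightarrow> indets q \<subseteq> V \<Longrightarrow> p * q \<in> I"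
  using ideal_mult_left by (simp add: mult.commute)

lemma ideal_uminus: "p \<in> I \<Longrightarrow> - p \<in> I"
  using ideal_mult_left[of p "- 1"] by (simp add: indets_uminus indets_one)

lemma ideal_diff: "p \<in> I \<Longrightarrow> q \<in> I \<Longrightarrow> p - q \<in> I"
  using ideal_add[of p "- q"] ideal_uminus by simp

text \<open>Both \<open>subst \<sigma>\<close> and the identity are algebra homomorphisms, and they
  agree modulo \<open>I\<close> on the generators of \<open>K[V]\<close>.\<close>

lemma ideal_subst_diff:
  assumes p: "indets p \<subseteq> V" and \<sigma>: "\<And>i. i \<in> V \<Longrightarrow> indets (\<sigma> i) \<subseteq> V \<and> \<sigma> i - Indet i \<in> I"
  shows "subst \<sigma> p - p \<in> I"
  using p
proof (induction rule: polyring_induct)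
  case (add p q)
  then have "(subst \<sigma> p - p) + (subst \<sigma> q - q) \<in> I" by (intro ideal_add)
  then show ?case by (simp add: subst_add algebra_simps)
next
  case (mult p q)
  have "indets (subst \<sigma> q) \<subseteq> V" using indets_subst[of \<sigma> q] mult(2) \<sigma> by blast
  \<comment> \<open>The sum telescopes to
    \<open>subst \<sigma> p * subst \<sigma> q - p * q\<close>.\<close>
  with mult have "(subst \<sigma> p - p) * subst \<sigma> q + p * (subst \<sigma> q - q) \<in> I"
    by (intro ideal_add ideal_mult_left ideal_mult_right)
  then show ?case by (simp add: subst_mult algebra_simps)
qed (use \<sigma> ideal_zero in simp_all)

end

section \<open>Subspaces and linear parts of ideals\<close>

lemma ideal_span:
  fixes I :: "'k::field mpoly set"
  assumes I: "ideal I (polyring V)" and "S \<subseteq> I"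
  shows "kspace.span S \<subseteq> I"
proof (rule kspace.span_minimal[OF assms(2)])
  show "kspace.subspace I"
    by (rule kspace.subspaceI)
      (auto simp: cscale_def intro: ideal_zero[OF I] ideal_add[OF I] ideal_mult_left[OF I])
qed

text \<open>The elements of \<open>K[x_1,...,x_n]\<close> without constant term form an ideal that
  contains all the \<open>x_i\<close>.\<close>

lemma irrelevant_idealD:
  fixes p :: "'k::comm_ring_1 mpoly"
  assumes "p \<in> irrelevant_ideal n"
  shows "indets p \<subseteq> {1..n}" and "Poly_Mapping.lookup p 0 = 0"
proof -
  let ?M = "{p :: 'k mpoly. indets p \<subseteq> {1..n} \<and> Poly_Mapping.lookup p 0 = 0}"
  have "ideal ?M (polyring {1..n})"
  proof (rule ideal_polyringI)
    fix p q :: "'k mpoly" assume "p \<in> ?M" "indets q \<subseteq> {1..n}"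
    then show "q * p \<in> ?M" using indets_mult[of q p] by (auto simp: lookup_mult_0)
  next
    fix p q :: "'k mpoly" assume "p \<in> ?M" "q \<in> ?M"
    then show "p + q \<in> ?M" using indets_add[of p q] by (auto simp: lookup_add)
  qed (auto simp: indets_zero)
  moreover have "Indet ` {1..n} \<subseteq> ?M" by (auto simp: lookup_Indet)
  ultimately have "irrelevant_ideal n \<subseteq> ?M"
    unfolding irrelevant_ideal_def by (rule ring.genideal_minimal[OF ring_polyring])
  with assms show "indets p \<subseteq> {1..n}" "Poly_Mapping.lookup p 0 = 0" by blast+
qed

text \<open>If \<open>p\<close> has no constant term, the Leibniz rule makes
  \<open>Lin (q * p)\<close> the constant coefficient of \<open>q\<close> times
  \<open>Lin p\<close>. Hence \<open>?J\<close> is an ideal containing \<open>S\<close>, and so it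
  contains the ideal generated by \<open>S\<close>.\<close>

lemma Lin_space_genideal:
  fixes S :: "'k::field mpoly set"
  assumes S: "\<And>g. g \<in> S \<Longrightarrow> indets g \<subseteq> V \<and> Poly_Mapping.lookup g 0 = 0"
  shows "Lin_space (Idl\<^bsub>polyring V\<^esub> S) = kspace.span (Lin ` S)"
proof
  let ?J = "{p. indets p \<subseteq> V \<and> Poly_Mapping.lookup p 0 = 0 \<and> Lin p \<in> kspace.span (Lin ` S)}"
  have "ideal ?J (polyring V)"
  proof (rule ideal_polyringI)
    fix p q :: "'k mpoly" assume "p \<in> ?J" "indets q \<subseteq> V"
    then show "q * p \<in> ?J"
      using indets_mult[of q p] by (auto simp: lookup_mult_0 Lin_mult kspace.span_scale)
  next
    fix p q :: "'k mpoly" assume "p \<in> ?J" "q \<in> ?J"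
    then show "p + q \<in> ?J"
      using indets_add[of p q] by (auto simp: lookup_add Lin_add kspace.span_add)
  qed (auto simp: indets_zero kspace.span_zero)
  moreover have "S \<subseteq> ?J" using S by (auto intro: kspace.span_base)
  ultimately have "Idl\<^bsub>polyring V\<^esub> S \<subseteq> ?J"
    by (rule ring.genideal_minimal[OF ring_polyring])
  then show "Lin_space (Idl\<^bsub>polyring V\<^esub> S) \<subseteq> kspace.span (Lin ` S)"
    unfolding Lin_space_def by (intro kspace.span_minimal) auto
  show "kspace.span (Lin ` S) \<subseteq> Lin_space (Idl\<^bsub>polyring V\<^esub> S)"
    unfolding Lin_space_def using genideal_polyring(2)[of S V] S
    by (intro kspace.span_mono image_mono) blast
qed

section \<open>The steps of the procedure\<close>

text \<open>Greedy selection from the end of \<open>G\<close>: \<open>g\<close> is kept exactly if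
  \<open>f g\<close> lies outside the span of the images kept so far, which also makes it different
  from them.\<close>

lemma exists_independent_subseq:
  fixes f :: "'a \<Rightarrow> 'k::field mpoly"
  shows "\<exists>fs. subseq fs G \<and> distinct (map f fs) \<and> \<not> kspace.dependent (set (map f fs)) \<and>
    kspace.span (set (map f fs)) = kspace.span (f ` set G)"
proof (induction G)
  case Nil
  show ?case by (intro exI[of _ "[]"]) (simp add: kspace.independent_empty)
next
  case (Cons g G)
  then obtain fs where fs: "subseq fs G" "distinct (map f fs)"
    "\<not> kspace.dependent (set (map f fs))"
    "kspace.span (set (map f fs)) = kspace.span (f ` set G)"
    by blast
  have span_insert: "kspace.span (insert (f g) (set (map f fs))) = kspace.span (f ` set (g # G))"
    using fs(4) by (simp add: kspace.span_insert)
  show ?case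
  proof (cases "f g \<in> kspace.span (set (map f fs))")
    case True
    with fs span_insert show ?thesis
      by (intro exI[of _ fs]) (simp add: kspace.span_redundant list_emb_Cons)
  next
    case False
    then have "f g \<notin> set (map f fs)" using kspace.span_base by blast
    with False fs span_insert show ?thesis
      by (intro exI[of _ "g # fs"]) (simp add: kspace.independent_insert)
  qed
qed

lemma exists_step1:
  fixes G :: "'k::field mpoly list"
  assumes "Lin_space I = kspace.span (Lin ` set G)"
  shows "\<exists>fs. step1 I G fs"
proof -
  obtain fs where fs: "subseq fs G" "distinct (map Lin fs)"
    "\<not> kspace.dependent (set (map Lin fs))"
    "kspace.span (set (map Lin fs)) = kspace.span (Lin ` set G)"
    using exists_independent_subseq[of G Lin] by blast
  have "kspace.dim (Lin_space I) = card (set (map Lin fs))"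
    by (rule kspace.dim_eq_card[OF _ fs(3)]) (simp only: assms fs(4) kspace.span_span)
  with fs assms show ?thesis
    unfolding step1_def basis_tuple_def by (metis distinct_card length_map)
qed

text \<open>\<open>Z\<close> consists of the pivots of the linear parts, sorted by degree. This
  order stays fixed, and a nonzero summand of the determinant tells how to permute \<open>fs\<close>
  to match it.\<close>

lemma exists_step2:
  fixes fs :: "'k::field mpoly list"
  assumes fs: "basis_tuple (map Lin fs) (Lin_space I)" and ind: "\<And>f. f \<in> set fs \<Longrightarrow> indets f \<subseteq> {1..n}"
  shows "\<exists>fs' Z. step2 n W I fs fs' Z"
proof -
  let ?ls = "map Lin fs"
  let ?w = "\<lambda>z. wdeg W (Indet_pp z)"
  have basis: "distinct ?ls" "\<not> kspace.dependent (set ?ls)" "kspace.span (set ?ls) = Lin_space I"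
    using fs by (auto simp: basis_tuple_def)
  have lin: "Poly_Mapping.lookup l t = 0" if "l \<in> set ?ls" "t \<notin> Indet_pp ` {1..n}" for l t
  proof -
    obtain f where f: "f \<in> set fs" "l = Lin f" using \<open>l \<in> set ?ls\<close> by auto
    show ?thesis
    proof (cases "wdeg (\<lambda>_. 1) t = 1")
      case True
      then obtain i where i: "t = Indet_pp i" by (auto simp: total_deg_eq_1_iff)
      with that(2) ind[OF f(1)] have "i \<notin> indets f" by auto
      then show ?thesis
        using lookup_eq_0_if_not_indet[of i f t] by (simp add: f i)
    qed (simp add: f lookup_Lin)
  qed
  obtain Zs d where Zs: "Zs \<subseteq> {1..n}" "finite Zs" "card Zs = card (set ?ls)"
    "dual_family (kspace.span (set ?ls)) Zs d"
    by (rule echelon_basis[OF _ basis(2) lin]) auto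
  define Z where "Z = sort_key ?w (sorted_list_of_set Zs)"
  have Z: "set Z = Zs" "distinct Z" "sorted (map ?w Z)"
    using Zs(2) by (simp_all add: Z_def)
  have len: "length Z = length fs"
    using Zs(3) distinct_card[OF basis(1)] distinct_card[OF Z(2)] Z(1) by simp
  \<comment> \<open>The dual family refers to \<open>Lin_space I\<close> only, so full rank holds
    for every spanning list, as \<open>top_rank\<close> requires.\<close>
  have rank: "vec_space.rank (length ls) (column_matrix ls Z) = length Z"
    if "kspace.span (set ls) = Lin_space I" for ls
    using rank_column_matrix[OF Z(2), of ls d] Zs(4) that basis(3) Z(1) by simp
  let ?A = "column_matrix ?ls Z"
  have A: "?A \<in> carrier_mat (length fs) (length fs)"
    using column_matrix_carrier[of ?ls Z] len by simp
  have "det ?A \<noteq> 0"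
    using det_column_matrix_nonzero_iff[of Z ?ls] rank[OF basis(3)] len by simp
  from exists_transversal[OF A this] obtain p
    where p: "p permutes {0..<length fs}" "\<forall>i<length fs. ?A $$ (p i, i) \<noteq> 0" by blast
  have pl: "p permutes {..<length fs}" using p(1) by (simp add: atLeast0LessThan)
  have "step2 n W I fs (permute_list p fs) Z"
    unfolding step2_def top_rank_def
  proof (intro conjI allI impI)
    fix i assume i: "i < length Z"
    have "p i < length fs" using permutes_in_image[OF p(1), of i] i len by simp
    then have "Poly_Mapping.lookup (fs ! p i) (Indet_pp (Z ! i)) \<noteq> 0"
      using p(2) i len by (auto simp: column_matrix_def)
    then show "Indet_pp (Z ! i) \<in> Supp (Lin (permute_list p fs ! i))"
      using i len pl by (simp add: permute_list_nth Supp_def in_keys_iff)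
  qed (use Z Zs(1) len rank pl in \<open>auto simp: column_matrix_def\<close>)
  then show ?thesis by blast
qed

lemma W_homogeneous_iff: "W_homogeneous W p \<longleftrightarrow> (\<exists>d. of_wdeg W d p)"
  by (simp add: W_homogeneous_def of_wdeg_def)

text \<open>The inverse of the coefficient matrix turns the linear parts into unit vectors on
  \<open>Z\<close>, but its rows may mix degrees. Keeping only the summands of the degree of
  \<open>z_i\<close> makes the combination homogeneous without altering its coefficients at
  \<open>Z\<close>.\<close>

lemma exists_step3:
  fixes fs :: "'k::field mpoly list"
  assumes fs: "basis_tuple (map Lin fs) (Lin_space I)" and st: "step2 n W I fs fs' Z"
    and G: "\<And>f. f \<in> set fs \<Longrightarrow> indets f \<subseteq> {1..n} \<and> W_homogeneous W f"
  shows "\<exists>F. step3 n W fs' Z F"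
proof -
  let ?ls = "map Lin fs'" and ?s = "length Z"
  have Z: "distinct Z" "set Z \<subseteq> {1..n}" "top_rank n Z (Lin_space I)"
    and ms: "mset fs' = mset fs" and len: "length Z = length fs"
    using st by (auto simp: step2_def top_rank_def)
  have set: "set fs' = set fs" and len': "length fs' = ?s"
    using mset_eq_setD[OF ms] mset_eq_length[OF ms] len by simp_all
  have "kspace.span (set ?ls) = Lin_space I" using fs set by (simp add: basis_tuple_def)
  then have "vec_space.rank (length ?ls) (column_matrix ?ls Z) = length Z"
    using Z(3) unfolding top_rank_def column_matrix_def by blast
  then have det: "det (column_matrix ?ls Z) \<noteq> 0"
    using det_column_matrix_nonzero_iff[of Z ?ls] len' by simp
  have "column_matrix ?ls Z \<in> carrier_mat ?s ?s"
    using column_matrix_carrier[of ?ls Z] len' by simp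
  from exists_left_inverse[OF this det]
  obtain b where b: "\<forall>i<?s. \<forall>k<?s.
      (\<Sum>j<?s. b i j * column_matrix ?ls Z $$ (j, k)) = (if i = k then 1 else 0)" ..
  have b: "(\<Sum>j<?s. b i j * Poly_Mapping.lookup (fs' ! j) (Indet_pp (Z ! k))) =
      (if i = k then 1 else 0)" if "i < ?s" "k < ?s" for i k
    using b[rule_format, OF that] that len' by (simp add: column_matrix_def)
  define w where "w i = wdeg W (Indet_pp (Z ! i))" for i
  define c where "c i j = (if of_wdeg W (w i) (fs' ! j) then b i j else 0)" for i j
  define f where "f i = (\<Sum>j<?s. cscale (c i j) (fs' ! j))" for i
  have f_coef: "Poly_Mapping.lookup (f i) (Indet_pp (Z ! k)) = (if i = k then 1 else 0)"
    if i: "i < ?s" and k: "k < ?s" for i k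
  proof (cases "w i = w k")
    case True
    \<comment> \<open>A summand discarded by \<open>c\<close> does not have the degree of
      \<open>z_k\<close>, so its coefficient at \<open>z_k\<close> was zero already.\<close>
    have "c i j * Poly_Mapping.lookup (fs' ! j) (Indet_pp (Z ! k)) =
      b i j * Poly_Mapping.lookup (fs' ! j) (Indet_pp (Z ! k))" if j: "j < ?s" for j
    proof (rule ccontr)
      assume *: "\<not> ?thesis"
      then have "Indet_pp (Z ! k) \<in> Supp (fs' ! j)" by (auto simp: Supp_def in_keys_iff)
      moreover obtain e where e: "of_wdeg W e (fs' ! j)"
        using G[of "fs' ! j"] j len' set by (metis W_homogeneous_iff nth_mem)
      ultimately have "e = w k" by (auto simp: of_wdeg_def w_def)
      with * e True show False by (simp add: c_def)
    qed
    then have "(\<Sum>j<?s. c i j * Poly_Mapping.lookup (fs' ! j) (Indet_pp (Z ! k))) =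
        (\<Sum>j<?s. b i j * Poly_Mapping.lookup (fs' ! j) (Indet_pp (Z ! k)))"
      by (intro sum.cong refl) (simp only: lessThan_iff)
    then show ?thesis using b[OF i k] by (simp only: f_def lookup_sum lookup_cscale)
  next
    case False
    \<comment> \<open>Here the summands that are kept have the degree of \<open>z_i\<close>, so
      \<open>z_k\<close> is not among their terms.\<close>
    have "c i j * Poly_Mapping.lookup (fs' ! j) (Indet_pp (Z ! k)) = 0" for j
    proof (rule ccontr)
      assume "\<not> ?thesis"
      then have "of_wdeg W (w i) (fs' ! j)" "Indet_pp (Z ! k) \<in> Supp (fs' ! j)"
        by (auto simp: c_def Supp_def in_keys_iff split: if_splits)
      with False show False by (auto simp: of_wdeg_def w_def)
    qed
    then show ?thesis using False by (auto simp: f_def lookup_sum)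
  qed
  have "step3 n W fs' Z (map f [0..<?s])"
    unfolding step3_def
  proof (intro conjI allI impI)
    fix i assume i: "i < ?s"
    then have fi: "map f [0..<?s] ! i = f i" by simp
    have "of_wdeg W (w i) (f i)"
      unfolding f_def by (intro of_wdeg_sum) (auto simp: c_def of_wdeg_0 intro: of_wdeg_cscale)
    then show "W_homogeneous W (map f [0..<?s] ! i)" unfolding fi by (auto simp: W_homogeneous_iff)
    show "map f [0..<?s] ! i \<in> kspace.span (set fs')"
      unfolding fi f_def using len' by (intro kspace.span_sum kspace.span_scale kspace.span_base) auto
    have "indets (cscale (c i j) (fs' ! j)) \<subseteq> {1..n}" if "j < ?s" for j
      using indets_cscale[of "c i j" "fs' ! j"] G[of "fs' ! j"] that len' set nth_mem[of j fs'] by auto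
    then have "indets (f i) \<subseteq> {1..n}"
      unfolding f_def using indets_sum[of "\<lambda>j. cscale (c i j) (fs' ! j)" "{..<?s}"] by fastforce
    moreover have "Z ! i \<in> {1..n}" using i Z(2) nth_mem by blast
    ultimately have h: "indets (hpart (Z ! i) (f i)) \<subseteq> {1..n}"
      unfolding hpart_def using indets_diff[of "Indet (Z ! i)" "f i"] by auto
    then show "hpart (Z ! i) (map f [0..<?s] ! i) \<in> carrier (polyring {1..n})"
      unfolding fi by simp
    show "Lin (hpart (Z ! i) (map f [0..<?s] ! i)) \<in> carrier (polyring ({1..n} - set Z))"
      unfolding fi carrier_polyring
    proof
      fix x assume "x \<in> indets (Lin (hpart (Z ! i) (f i)))"
      then obtain t where t: "x \<in> Poly_Mapping.keys t"
        "Poly_Mapping.lookup (Lin (hpart (Z ! i) (f i))) t \<noteq> 0"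
        by (auto simp: indets_def Supp_def in_keys_iff)
      then have "wdeg (\<lambda>_. 1) t = 1" by (auto simp: lookup_Lin split: if_splits)
      with t(1) have "t = Indet_pp x" by (auto simp: total_deg_eq_1_iff)
      with t(2) have x: "Poly_Mapping.lookup (hpart (Z ! i) (f i)) (Indet_pp x) \<noteq> 0" by simp
      then have "x \<in> {1..n}" using h lookup_eq_0_if_not_indet[of x "hpart (Z ! i) (f i)" "Indet_pp x"] keys_Indet_pp[of x] by blast
      moreover have "x \<notin> set Z"
      proof
        assume "x \<in> set Z"
        then obtain k where "k < ?s" "x = Z ! k" by (metis in_set_conv_nth)
        with x i Z(1) show False
          by (auto simp: hpart_def lookup_minus lookup_Indet f_coef nth_eq_iff_index_eq split: if_splits)
      qed
      ultimately show "x \<in> {1..n} - set Z" by blast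
    qed
  qed simp
  then show ?thesis by blast
qed

subsection \<open>The substitutions\<close>

lemma hpart_subst_indet:
  "z \<noteq> z' \<Longrightarrow> hpart z (subst_indet z' h f) = subst_indet z' h (hpart z f)"
  by (simp add: hpart_def subst_indet_def subst_diff)

lemma fold_concat: "fold f (concat xss) = fold (fold f) xss"
  by (induction xss) auto

definition substitution_round :: "nat list \<Rightarrow> nat \<Rightarrow> 'k::field mpoly list \<Rightarrow> 'k mpoly list" where
  "substitution_round Z i = fold (substitute_at Z) (map (Pair i) [Suc i..<length Z])"

lemma step4_conv_rounds: "step4 Z = fold (substitution_round Z) [0..<length Z]"
  by (intro ext) (simp add: step4_def fold_concat substitution_round_def[abs_def] fold_map comp_def)

text \<open>Entry \<open>i\<close> is never overwritten because \<open>j\<close> starts at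
  \<open>Suc i\<close>; hence all substitutions of a round use the same \<open>h_i\<close>. The
  bound \<open>m\<close> permits induction along the round.\<close>

lemma substitution_round_partial:
  assumes "m \<le> length F"
  shows "length (fold (substitute_at Z) (map (Pair i) [Suc i..<m]) F) = length F \<and>
    (\<forall>k<length F. fold (substitute_at Z) (map (Pair i) [Suc i..<m]) F ! k =
      (if i < k \<and> k < m then subst_indet (Z ! i) (hpart (Z ! i) (F ! i)) (F ! k) else F ! k))"
  using assms
proof (induction m)
  case (Suc m)
  then show ?case
    by (cases "Suc i \<le> m") (auto simp: substitute_at_def nth_list_update less_Suc_eq)
qed simp

lemma substitution_round:
  assumes "length F = length Z"
  shows "length (substitution_round Z i F) = length Z"
    and "k < length Z \<Longrightarrow> substitution_round Z i F ! k =
      (if i < k then subst_indet (Z ! i) (hpart (Z ! i) (F ! i)) (F ! k) else F ! k)"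
  using substitution_round_partial[of "length Z" F Z i] assms
  by (simp_all add: substitution_round_def)

text \<open>After the first \<open>m\<close> rounds, \<open>h\<^sub>k\<close> only involves those indeterminates of \<open>Z\<close> that precede
  \<open>z\<^sub>k\<close> and have not been substituted yet.\<close>

definition step4_invariant ::
  "nat \<Rightarrow> (nat \<Rightarrow> int) \<Rightarrow> 'k::field mpoly set \<Rightarrow> nat list \<Rightarrow> nat \<Rightarrow> 'k mpoly list \<Rightarrow> bool" where
  "step4_invariant n W I Z m F \<longleftrightarrow> length F = length Z \<and> (\<forall>k<length Z.
    F ! k \<in> I \<and> of_wdeg W (W (Z ! k)) (F ! k) \<and> indets (hpart (Z ! k) (F ! k)) \<subseteq> {1..n} \<and>
    (\<forall>k'<length Z. Z ! k' \<in> indets (hpart (Z ! k) (F ! k)) \<longrightarrow> m \<le> k' \<and> k' < k))"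

text \<open>At round \<open>m\<close> the polynomial \<open>h_m\<close> is already free of
  \<open>Z\<close>. Substituting it removes \<open>z_m\<close> from the later \<open>h_k\<close> and
  introduces no other member of \<open>Z\<close>.\<close>

lemma step4_invariant_round:
  fixes F :: "'k::field mpoly list"
  assumes I: "ideal I (polyring {1..n})" and Z: "distinct Z" "set Z \<subseteq> {1..n}"
    and inv: "step4_invariant n W I Z m F" and m: "m < length Z"
  shows "step4_invariant n W I Z (Suc m) (substitution_round Z m F)"
proof -
  define h where "h = hpart (Z ! m) (F ! m)"
  have len: "length F = length Z" using inv by (simp add: step4_invariant_def)
  have F: "F ! k \<in> I" "of_wdeg W (W (Z ! k)) (F ! k)" "indets (hpart (Z ! k) (F ! k)) \<subseteq> {1..n}"
    "k' < length Z \<Longrightarrow> Z ! k' \<in> indets (hpart (Z ! k) (F ! k)) \<Longrightarrow> m \<le> k' \<and> k' < k"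
    if "k < length Z" for k k'
    using inv that unfolding step4_invariant_def by blast+
  have h_deg: "of_wdeg W (W (Z ! m)) h"
    unfolding h_def hpart_def using F(2)[OF m] by (intro of_wdeg_diff of_wdeg_Indet)
  have h_I: "h - Indet (Z ! m) \<in> I"
    using ideal_uminus[OF I F(1)[OF m]] by (simp add: h_def hpart_def)
  have h_ind: "indets h \<subseteq> {1..n}" using F(3)[OF m] by (simp add: h_def)
  \<comment> \<open>Otherwise the invariant would give \<open>m \<le> k'\<close> and
    \<open>k' < m\<close>.\<close>
  have h_Z: "Z ! k' \<notin> indets h" if "k' < length Z" for k'
    using F(4)[OF m that] by (auto simp: h_def)
  note round = substitution_round[OF len, where i = m]
  show ?thesis
    unfolding step4_invariant_def
  proof (intro conjI allI impI)
    show "length (substitution_round Z m F) = length Z" by (rule round(1))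
  next
    fix k assume k: "k < length Z"
    let ?f = "substitution_round Z m F ! k"
    show "?f \<in> I"
    proof (cases "m < k")
      case True
      \<comment> \<open>Replacing \<open>z_m\<close> by \<open>h_m\<close> changes nothing modulo
        \<open>I\<close>.\<close>
      have "subst_indet (Z ! m) h (F ! k) - F ! k \<in> I"
        unfolding subst_indet_def
      proof (rule ideal_subst_diff[OF I ideal_indets[OF I F(1)[OF k]]])
        show "indets ((Indet(Z ! m := h)) i) \<subseteq> {1..n} \<and> (Indet(Z ! m := h)) i - Indet i \<in> I"
          if "i \<in> {1..n}" for i
          using that h_ind h_I ideal_zero[OF I] by auto
      qed
      from ideal_add[OF I this F(1)[OF k]] True round(2)[OF k] show ?thesis by (simp add: h_def)
    qed (use round(2)[OF k] F(1)[OF k] in simp)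
    show "of_wdeg W (W (Z ! k)) ?f"
    proof (cases "m < k")
      case True
      have "of_wdeg W (W (Z ! k)) (subst_indet (Z ! m) h (F ! k))"
        unfolding subst_indet_def using F(2)[OF k] h_deg
        by (intro of_wdeg_subst) (auto intro: of_wdeg_Indet)
      with True round(2)[OF k] show ?thesis by (simp add: h_def)
    qed (use round(2)[OF k] F(2)[OF k] in simp)
    \<comment> \<open>The substitution fixes \<open>z_k\<close> because \<open>z_k\<close> differs
      from \<open>z_m\<close>, so it acts on \<open>h_k\<close> in the same way as on
      \<open>F ! k\<close>.\<close>
    have hk: "hpart (Z ! k) ?f = (if m < k then subst_indet (Z ! m) h (hpart (Z ! k) (F ! k))
        else hpart (Z ! k) (F ! k))"
      using round(2)[OF k] Z(1) k m
      by (auto simp: h_def nth_eq_iff_index_eq intro!: hpart_subst_indet)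
    have ind: "indets (hpart (Z ! k) ?f) \<subseteq>
        (if m < k then (indets (hpart (Z ! k) (F ! k)) - {Z ! m}) \<union> indets h
         else indets (hpart (Z ! k) (F ! k)))"
      using indets_subst_indet[of "Z ! m" h] by (auto simp: hk)
    then show "indets (hpart (Z ! k) ?f) \<subseteq> {1..n}"
      using F(3)[OF k] h_ind by (auto split: if_splits)
    fix k' assume k': "k' < length Z" "Z ! k' \<in> indets (hpart (Z ! k) ?f)"
    have *: "Z ! k' \<in> indets (hpart (Z ! k) (F ! k))" and neq: "m < k \<Longrightarrow> k' \<noteq> m"
      using ind k' h_Z[OF k'(1)] by (auto split: if_splits)
    \<comment> \<open>For \<open>k \<le> m\<close> the old bounds \<open>m \<le> k'\<close> and
      \<open>k' < k\<close> are contradictory; otherwise \<open>k' \<noteq> m\<close> improves the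
      lower bound by one.\<close>
    from F(4)[OF k k'(1) *] neq show "Suc m \<le> k'" "k' < k" by linarith+
  qed
qed

text \<open>A term of \<open>h\<^sub>k\<close> divisible by \<open>z\<^sub>j\<close> is not \<open>z\<^sub>j\<close> itself, so that by positivity of the grading
  \<open>z\<^sub>j\<close> has smaller degree than \<open>z\<^sub>k\<close>, whence \<open>j < k\<close>.\<close>

lemma step4_invariant_0:
  fixes F :: "'k::field mpoly list"
  assumes I: "ideal I (polyring {1..n})" and W: "positive_grading n W"
    and Z: "distinct Z" "set Z \<subseteq> {1..n}" "sorted (map (\<lambda>z. wdeg W (Indet_pp z)) Z)"
    and st: "step3 n W fs' Z F" and sub: "set fs' \<subseteq> I"
  shows "step4_invariant n W I Z 0 F"
  unfolding step4_invariant_def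
proof (intro conjI allI impI)
  show "length F = length Z" using st by (simp add: step3_def)
next
  fix k assume k: "k < length Z"
  let ?h = "hpart (Z ! k) (F ! k)"
  have F: "W_homogeneous W (F ! k)" "F ! k \<in> kspace.span (set fs')" "indets ?h \<subseteq> {1..n}"
    "indets (Lin ?h) \<subseteq> {1..n} - set Z"
    using st k by (auto simp: step3_def)
  show "F ! k \<in> I" using ideal_span[OF I sub] F(2) by blast
  show "indets ?h \<subseteq> {1..n}" by (fact F(3))
  have h0: "Poly_Mapping.lookup ?h (Indet_pp z) = 0" if "z \<in> set Z" for z
    using lookup_eq_0_if_not_indet[of z "Lin ?h" "Indet_pp z"] F(4) that by auto
  \<comment> \<open>The coefficient of \<open>z_k\<close> in \<open>F ! k\<close> is one, which pins
    the weighted degree of \<open>F ! k\<close> to that of \<open>z_k\<close>.\<close>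
  have "Poly_Mapping.lookup (F ! k) (Indet_pp (Z ! k)) = 1"
    using h0[of "Z ! k"] k by (simp add: hpart_def lookup_minus lookup_Indet)
  then have "Indet_pp (Z ! k) \<in> Supp (F ! k)" by (simp add: Supp_def in_keys_iff)
  with F(1) show deg: "of_wdeg W (W (Z ! k)) (F ! k)"
    by (metis W_homogeneous_iff of_wdeg_def wdeg_Indet_pp)
  then have h_deg: "of_wdeg W (W (Z ! k)) ?h"
    unfolding hpart_def by (intro of_wdeg_diff of_wdeg_Indet)
  fix j assume j: "j < length Z" "Z ! j \<in> indets ?h"
  then obtain t where t: "t \<in> Supp ?h" "Z ! j \<in> Poly_Mapping.keys t" by (auto simp: indets_def)
  from t(2) obtain u where u: "t = Indet_pp (Z ! j) + u" by (rule Indet_pp_dvd)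
  have "u \<noteq> 0" using t(1) u h0[of "Z ! j"] j(1) by (auto simp: Supp_def in_keys_iff)
  moreover have "0 < W i" if "i \<in> Poly_Mapping.keys u" for i
  proof -
    have "i \<in> Poly_Mapping.keys t" using that by (auto simp: u in_keys_iff lookup_add)
    then have "i \<in> {1..n}" using t(1) F(3) by (auto simp: indets_def)
    then show ?thesis using W by (simp add: positive_grading_def)
  qed
  ultimately have "0 < wdeg W u" by (intro wdeg_pos)
  moreover have "wdeg W t = W (Z ! k)" using h_deg t(1) by (simp add: of_wdeg_def)
  ultimately have less: "W (Z ! j) < W (Z ! k)" by (simp add: u wdeg_add)
  show "0 \<le> j" by simp
  show "j < k"
  proof (rule ccontr)
    assume "\<not> j < k"
    with Z(3) j(1) have "W (Z ! k) \<le> W (Z ! j)"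
      by (simp add: sorted_iff_nth_mono)
    with less show False by simp
  qed
qed

lemma step4_invariant_final:
  fixes F :: "'k::field mpoly list"
  assumes I: "ideal I (polyring {1..n})" and W: "positive_grading n W"
    and Z: "distinct Z" "set Z \<subseteq> {1..n}" "sorted (map (\<lambda>z. wdeg W (Indet_pp z)) Z)"
    and st: "step3 n W fs' Z F" and sub: "set fs' \<subseteq> I"
  shows "step4_invariant n W I Z (length Z) (step4 Z F)"
proof -
  have "step4_invariant n W I Z m (fold (substitution_round Z) [0..<m] F)" if "m \<le> length Z" for m
    using that
  proof (induction m)
    case 0
    then show ?case using step4_invariant_0[OF assms] by simp
  next
    case (Suc m)
    then show ?case using step4_invariant_round[OF I Z(1,2), of W m] by simp
  qed
  then show ?thesis by (simp add: step4_conv_rounds)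
qed

text \<open>For \<open>m = length Z\<close> no index satisfies both \<open>m \<le> k'\<close> and
  \<open>k' < length Z\<close>, so no member of \<open>Z\<close> is left in any
  \<open>h_k\<close>.\<close>

lemma step4_invariantD:
  assumes "step4_invariant n W I Z (length Z) F" and Z: "distinct Z" "set Z \<subseteq> {1..n}"
  shows "coherently_separating n Z F" and "\<forall>f\<in>set F. f \<in> I \<and> W_homogeneous W f"
    and "k < length Z \<Longrightarrow> indets (hpart (Z ! k) (F ! k)) \<subseteq> {1..n} - set Z"
proof -
  have len: "length F = length Z" using assms(1) by (simp add: step4_invariant_def)
  have F: "F ! k \<in> I" "of_wdeg W (W (Z ! k)) (F ! k)" "indets (hpart (Z ! k) (F ! k)) \<subseteq> {1..n}"
    "k' < length Z \<Longrightarrow> Z ! k' \<notin> indets (hpart (Z ! k) (F ! k))"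
    if "k < length Z" for k k'
    using assms(1) that unfolding step4_invariant_def by (blast, blast, blast, fastforce)
  show "\<forall>f\<in>set F. f \<in> I \<and> W_homogeneous W f"
    using F(1,2) len by (metis W_homogeneous_iff in_set_conv_nth)
  show "indets (hpart (Z ! k) (F ! k)) \<subseteq> {1..n} - set Z" if "k < length Z" for k
    using F(3,4)[OF that] by (auto simp: in_set_conv_nth)
  show "coherently_separating n Z F"
    unfolding coherently_separating_def
    using Z len F(3,4) by (auto simp: pp_dvd_Indet_pp indets_def)
qed

section \<open>Re-embeddings\<close>

lemma rcos_polyring_eq_iff:
  fixes I :: "'k::comm_ring_1 mpoly set"
  assumes I: "ideal I (polyring V)" and "indets p \<subseteq> V" "indets q \<subseteq> V"
  shows "I +>\<^bsub>polyring V\<^esub> p = I +>\<^bsub>polyring V\<^esub> q \<longleftrightarrow> p - q \<in> I"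
proof -
  interpret R: cring "polyring V :: 'k mpoly ring" by (rule cring_polyring)
  have "\<ominus>\<^bsub>polyring V\<^esub> q = - q"
    using assms(3) by (intro R.minus_equality) (auto simp: indets_uminus)
  then have "p \<ominus>\<^bsub>polyring V\<^esub> q = p - q" by (simp add: a_minus_def)
  with R.quotient_eq_iff_same_a_r_cos[OF I, of p q] assms(2,3) show ?thesis by simp
qed

lemma carrier_Quot: "carrier (R Quot I) = {I +>\<^bsub>R\<^esub> p |p. p \<in> carrier R}"
  by (auto simp: FactRing_def A_RCOSETS_def')

lemma subst_ring_hom:
  fixes \<sigma> :: "nat \<Rightarrow> 'k::comm_ring_1 mpoly"
  assumes "\<And>i. i \<in> V \<Longrightarrow> indets (\<sigma> i) \<subseteq> Y"
  shows "subst \<sigma> \<in> Ring.ring_hom (polyring V) (polyring Y)"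
proof (rule ring_hom_memI)
  fix p :: "'k mpoly" assume "p \<in> carrier (polyring V)"
  then show "subst \<sigma> p \<in> carrier (polyring Y)" using indets_subst[of \<sigma> p] assms by fastforce
next
  show "subst \<sigma> \<one>\<^bsub>polyring V\<^esub> = \<one>\<^bsub>polyring Y\<^esub>"
    using subst_Const[of \<sigma> 1] by (simp del: subst_Const)
qed (simp_all add: subst_add subst_mult)

lemma ideal_contraction:
  fixes I :: "'k::comm_ring_1 mpoly set"
  assumes I: "ideal I (polyring V)" and "Y \<subseteq> V"
  shows "ideal (I \<inter> carrier (polyring Y)) (polyring Y)"
proof (rule ideal_polyringI)
  fix p q :: "'k mpoly" assume "p \<in> I \<inter> carrier (polyring Y)" "q \<in> I \<inter> carrier (polyring Y)"
  then show "p + q \<in> I \<inter> carrier (polyring Y)"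
    using indets_add[of p q] by (auto intro: ideal_add[OF I])
next
  fix p q :: "'k mpoly" assume "p \<in> I \<inter> carrier (polyring Y)" "indets q \<subseteq> Y"
  then show "q * p \<in> I \<inter> carrier (polyring Y)"
    using indets_mult[of q p] assms(2) by (auto intro!: ideal_mult_left[OF I])
qed (auto simp: indets_zero intro: ideal_zero[OF I])

text \<open>First isomorphism theorem for \<open>\<phi>\<close>, the substitution of
  \<open>z_k\<close> by \<open>h_k\<close> followed by reduction modulo \<open>J\<close>. It is onto
  because the substitution fixes \<open>K[Y]\<close>, and its kernel is \<open>I\<close> because the
  substitution is the identity modulo \<open>I\<close>.\<close>

lemma exists_separating_reembedding:
  fixes I :: "'k::field mpoly set"
  assumes I: "ideal I (polyring {1..n})" and Z: "distinct Z" "set Z \<subseteq> {1..n}" "length F = length Z"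
    and F: "\<And>k. k < length Z \<Longrightarrow> F ! k \<in> I"
    and h: "\<And>k. k < length Z \<Longrightarrow> indets (hpart (Z ! k) (F ! k)) \<subseteq> {1..n} - set Z"
  shows "\<exists>\<Phi>. separating_reembedding n I Z F \<Phi>"
proof -
  define Y where "Y = {1..n} - set Z"
  let ?R = "polyring {1..n} :: 'k mpoly ring" and ?S = "polyring Y :: 'k mpoly ring"
  define J where "J = I \<inter> carrier ?S"
  \<comment> \<open>The case \<open>None\<close> is that of an indeterminate outside
    \<open>Z\<close>, which stays fixed.\<close>
  define \<sigma> where "\<sigma> i = (case map_of (zip Z F) i of None \<Rightarrow> Indet i | Some f \<Rightarrow> hpart i f)" for i
  have \<sigma>Z: "\<sigma> (Z ! k) = hpart (Z ! k) (F ! k)" if "k < length Z" for k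
    using that Z by (simp add: \<sigma>_def map_of_zip_nth)
  have \<sigma>Y: "\<sigma> i = Indet i" if "i \<notin> set Z" for i
    using that by (auto simp: \<sigma>_def dest!: map_of_SomeD set_zip_leftD split: option.split)
  have \<sigma>: "indets (\<sigma> i) \<subseteq> Y" "\<sigma> i - Indet i \<in> I" if i: "i \<in> {1..n}" for i
  proof -
    have "indets (\<sigma> i) \<subseteq> Y \<and> \<sigma> i - Indet i \<in> I"
    proof (cases "i \<in> set Z")
      case True
      then obtain k where k: "k < length Z" "i = Z ! k" by (metis in_set_conv_nth)
      then show ?thesis
        using h[OF k(1)] ideal_uminus[OF I F[OF k(1)]] by (simp add: \<sigma>Z Y_def) (simp add: hpart_def)
    next
      case False
      with i show ?thesis by (simp add: \<sigma>Y Y_def ideal_zero[OF I])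
    qed
    then show "indets (\<sigma> i) \<subseteq> Y" "\<sigma> i - Indet i \<in> I" by blast+
  qed
  have YV: "Y \<subseteq> {1..n}" by (auto simp: Y_def)
  have J: "ideal J ?S" unfolding J_def by (rule ideal_contraction[OF I YV])
  have subst_Y: "indets (subst \<sigma> p) \<subseteq> Y" if "indets p \<subseteq> {1..n}" for p
    using indets_subst[of \<sigma> p] \<sigma>(1) that by fastforce
  have subst_diff_I: "subst \<sigma> p - p \<in> I" if "indets p \<subseteq> {1..n}" for p
    using that \<sigma> YV by (intro ideal_subst_diff[OF I]) blast+
  define \<phi> where "\<phi> = (\<lambda>p. J +>\<^bsub>?S\<^esub> p) \<circ> subst \<sigma>"
  have "\<phi> \<in> Ring.ring_hom ?R (?S Quot J)"
    unfolding \<phi>_def by (rule ring_hom_trans[OF subst_ring_hom ideal.rcos_ring_hom[OF J]]) (rule \<sigma>(1))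
  then interpret \<phi>: ring_hom_ring ?R "?S Quot J" \<phi>
    by (intro ring_hom_ringI2 ring_polyring ideal.quotient_is_ring[OF J])
  have J_rcos_0: "J +>\<^bsub>?S\<^esub> 0 = J"
    using additive_subgroup.a_subset[OF ideal.axioms(1)[OF J]]
    by (auto simp: a_r_coset_def' )
  have ker: "a_kernel ?R (?S Quot J) \<phi> = I"
  proof -
    have "\<phi> p = \<zero>\<^bsub>?S Quot J\<^esub> \<longleftrightarrow> p \<in> I" if p: "indets p \<subseteq> {1..n}" for p
    proof -
      have "\<phi> p = \<zero>\<^bsub>?S Quot J\<^esub> \<longleftrightarrow> J +>\<^bsub>?S\<^esub> subst \<sigma> p = J +>\<^bsub>?S\<^esub> 0"
        by (simp add: \<phi>_def FactRing_def J_rcos_0)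
      also have "\<dots> \<longleftrightarrow> subst \<sigma> p \<in> J"
        using rcos_polyring_eq_iff[OF J subst_Y[OF p], of 0] by (simp add: indets_zero)
      also have "\<dots> \<longleftrightarrow> subst \<sigma> p \<in> I" using subst_Y[OF p] by (simp add: J_def)
      also have "\<dots> \<longleftrightarrow> p \<in> I"
        using ideal_add[OF I subst_diff_I[OF p], of p] ideal_diff[OF I _ subst_diff_I[OF p], of "subst \<sigma> p"]
        by auto
      finally show ?thesis .
    qed
    then show ?thesis
      unfolding a_kernel_def' carrier_polyring using ideal_indets[OF I] by blast
  qed
  have surj: "\<phi> ` carrier ?R = carrier (?S Quot J)"
  proof
    show "carrier (?S Quot J) \<subseteq> \<phi> ` carrier ?R"
    proof
      fix X assume "X \<in> carrier (?S Quot J)"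
      then obtain q where q: "indets q \<subseteq> Y" "X = J +>\<^bsub>?S\<^esub> q" by (auto simp: carrier_Quot)
      have "subst \<sigma> q = q" using q(1) by (intro subst_id) (auto simp: Y_def \<sigma>Y)
      then have "X = \<phi> q" by (simp add: \<phi>_def q(2))
      with q(1) YV show "X \<in> \<phi> ` carrier ?R" by auto
    qed
  qed auto
  \<comment> \<open>On a coset of its kernel \<open>\<phi>\<close> takes a single value, so the
    image is a singleton.\<close>
  define \<Phi> where "\<Phi> X = the_elem (\<phi> ` X)" for X
  have \<Phi>: "\<Phi> (I +>\<^bsub>?R\<^esub> p) = J +>\<^bsub>?S\<^esub> subst \<sigma> p" if "indets p \<subseteq> {1..n}" for p
  proof -
    have "\<Phi> (I +>\<^bsub>?R\<^esub> p) = \<phi> p"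
      using \<phi>.the_elem_simp[of p] that unfolding ker carrier_polyring \<Phi>_def by blast
    then show ?thesis by (simp add: \<phi>_def)
  qed
  have "\<Phi> \<in> ring_iso (?R Quot I) (?S Quot J)"
    using \<phi>.FactRing_iso_set[OF surj] unfolding ker \<Phi>_def[abs_def] .
  moreover have "\<Phi> (I +>\<^bsub>?R\<^esub> Indet (Z ! k)) = J +>\<^bsub>?S\<^esub> hpart (Z ! k) (F ! k)"
    if "k < length Z" for k
  proof -
    have "Z ! k \<in> {1..n}" using Z(2) nth_mem[OF that] by blast
    then show ?thesis using \<Phi>[of "Indet (Z ! k)"] by (simp add: \<sigma>Z[OF that])
  qed
  moreover have "\<Phi> (I +>\<^bsub>?R\<^esub> Indet j) = J +>\<^bsub>?S\<^esub> Indet j" if "j \<in> Y" for j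
    using that \<Phi>[of "Indet j"] by (simp add: Y_def \<sigma>Y)
  moreover have "\<Phi> (I +>\<^bsub>?R\<^esub> Const c) = J +>\<^bsub>?S\<^esub> Const c" for c
    using \<Phi>[of "Const c"] by simp
  ultimately have "separating_reembedding n I Z F \<Phi>"
    unfolding separating_reembedding_def K_alg_iso_def Let_def Y_def[symmetric] J_def[symmetric]
    by blast
  then show ?thesis by blast
qed

section \<open>Lower bound for the number of indeterminates\<close>

text \<open>The \<open>n\<close> indeterminates are independent and lie in the span of
  \<open>B\<close> and the linear parts of lifts \<open>p y\<close> of the generators
  \<open>y\<close>. The lifts may have constant terms, since in the Leibniz rule these only act as
  scalars.\<close>

lemma K_alg_iso_lower_bound:
  fixes I :: "'k::field mpoly set"
  assumes I: "ideal I (polyring {1..n})" and J: "ideal J (polyring Y)"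
    and \<Psi>: "K_alg_iso {1..n} I Y J \<Psi>" and "finite Y"
    and B: "finite B" "Lin_space I = kspace.span B"
  shows "n \<le> card B + card Y"
proof -
  let ?R = "polyring {1..n} :: 'k mpoly ring" and ?S = "polyring Y :: 'k mpoly ring"
  have hom: "\<Psi> \<in> Ring.ring_hom (?R Quot I) (?S Quot J)"
    and bij: "bij_betw \<Psi> (carrier (?R Quot I)) (carrier (?S Quot J))"
    and const: "\<Psi> (I +>\<^bsub>?R\<^esub> Const c) = J +>\<^bsub>?S\<^esub> Const c" for c
    using \<Psi> by (auto simp: K_alg_iso_def ring_iso_def)
  have "\<exists>q. indets q \<subseteq> {1..n} \<and> \<Psi> (I +>\<^bsub>?R\<^esub> q) = J +>\<^bsub>?S\<^esub> Indet y" if "y \<in> Y" for y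
  proof -
    have "J +>\<^bsub>?S\<^esub> Indet y \<in> carrier (?S Quot J)" using that by (auto simp: carrier_Quot)
    then have "J +>\<^bsub>?S\<^esub> Indet y \<in> \<Psi> ` carrier (?R Quot I)"
      using bij by (simp add: bij_betw_def)
    then show ?thesis by (auto simp: carrier_Quot)
  qed
  then obtain p where p: "\<And>y. y \<in> Y \<Longrightarrow> indets (p y) \<subseteq> {1..n}"
    "\<And>y. y \<in> Y \<Longrightarrow> \<Psi> (I +>\<^bsub>?R\<^esub> p y) = J +>\<^bsub>?S\<^esub> Indet y"
    by metis
  have subst_p: "indets (subst p q) \<subseteq> {1..n}" if "indets q \<subseteq> Y" for q
    using indets_subst[of p q] p(1) that by fastforce
  have in_Quot: "I +>\<^bsub>?R\<^esub> q \<in> carrier (?R Quot I)" if "indets q \<subseteq> {1..n}" for q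
    using that by (auto simp: carrier_Quot)
  note hI = ideal.rcos_ring_hom[OF I] and hJ = ideal.rcos_ring_hom[OF J]
  \<comment> \<open>Substituting the lifts inverts \<open>\<Psi>\<close> on residue classes: this
    holds on constants and generators, and \<open>\<Psi>\<close> is a ring homomorphism.\<close>
  have \<Psi>_subst: "\<Psi> (I +>\<^bsub>?R\<^esub> subst p q) = J +>\<^bsub>?S\<^esub> q" if "indets q \<subseteq> Y" for q
    using that
  proof (induction rule: polyring_induct)
    case (add q r)
    have "\<Psi> (I +>\<^bsub>?R\<^esub> (subst p q + subst p r)) =
        \<Psi> (I +>\<^bsub>?R\<^esub> subst p q) \<oplus>\<^bsub>?S Quot J\<^esub> \<Psi> (I +>\<^bsub>?R\<^esub> subst p r)"
      using ring_hom_add[OF hI, of "subst p q" "subst p r"] ring_hom_add[OF hom in_Quot in_Quot]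
        subst_p[OF add(1)] subst_p[OF add(2)]
      by (simp only: carrier_polyring polyring_simps)
    also have "\<dots> = J +>\<^bsub>?S\<^esub> (q + r)"
      using ring_hom_add[OF hJ, of q r] add by simp
    finally show ?case by (simp add: subst_add)
  next
    case (mult q r)
    have "\<Psi> (I +>\<^bsub>?R\<^esub> (subst p q * subst p r)) =
        \<Psi> (I +>\<^bsub>?R\<^esub> subst p q) \<otimes>\<^bsub>?S Quot J\<^esub> \<Psi> (I +>\<^bsub>?R\<^esub> subst p r)"
      using ring_hom_mult[OF hI, of "subst p q" "subst p r"] ring_hom_mult[OF hom in_Quot in_Quot]
        subst_p[OF mult(1)] subst_p[OF mult(2)]
      by (simp only: carrier_polyring polyring_simps)
    also have "\<dots> = J +>\<^bsub>?S\<^esub> (q * r)"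
      using ring_hom_mult[OF hJ, of q r] mult by simp
    finally show ?case by (simp add: subst_mult)
  qed (simp_all only: subst_Const subst_Indet const p(2))
  have Lin_subst: "Lin (subst p q) \<in> kspace.span (Lin ` p ` Y)" if "indets q \<subseteq> Y" for q
    using that
    by (induction rule: polyring_induct)
      (auto simp: subst_add subst_mult Lin_add Lin_mult kspace.span_zero
        intro: kspace.span_add kspace.span_scale kspace.span_base)
  let ?T = "B \<union> Lin ` p ` Y"
  have "Indet i \<in> kspace.span ?T" if i: "i \<in> {1..n}" for i
  proof -
    have ind: "indets (Indet i :: 'k mpoly) \<subseteq> {1..n}" using i by simp
    have "\<Psi> (I +>\<^bsub>?R\<^esub> Indet i) \<in> carrier (?S Quot J)"
      using bij in_Quot[OF ind] by (auto simp: bij_betw_def)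
    then obtain q where q: "indets q \<subseteq> Y" "\<Psi> (I +>\<^bsub>?R\<^esub> Indet i) = J +>\<^bsub>?S\<^esub> q"
      by (auto simp: carrier_Quot)
    \<comment> \<open>Injectivity of \<open>\<Psi>\<close> turns the equality of images into a
      congruence modulo \<open>I\<close>.\<close>
    then have "I +>\<^bsub>?R\<^esub> Indet i = I +>\<^bsub>?R\<^esub> subst p q"
      using bij in_Quot[OF ind] in_Quot[OF subst_p[OF q(1)]] \<Psi>_subst[OF q(1)]
      unfolding bij_betw_def by (metis inj_onD)
    then have "Indet i - subst p q \<in> I"
      using rcos_polyring_eq_iff[OF I ind subst_p[OF q(1)]] by simp
    then have "Lin (Indet i - subst p q) \<in> kspace.span B"
      unfolding B(2)[symmetric] Lin_space_def by (intro kspace.span_base imageI)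
    then have "Lin (Indet i - subst p q) \<in> kspace.span ?T"
      using kspace.span_mono[of B ?T] by blast
    moreover have "Lin (subst p q) \<in> kspace.span ?T"
      using Lin_subst[OF q(1)] kspace.span_mono[of "Lin ` p ` Y" ?T] by blast
    ultimately have "Lin (Indet i - subst p q) + Lin (subst p q) \<in> kspace.span ?T"
      by (rule kspace.span_add)
    then show ?thesis by (simp add: Lin_diff)
  qed
  then have sub: "Indet ` {1..n} \<subseteq> kspace.span ?T" by blast
  have inj: "inj (Indet :: nat \<Rightarrow> 'k mpoly)"
    by (rule injI) (metis indets_Indet singleton_inject)
  have "kspace.independent (Indet ` {1..n} :: 'k mpoly set)"
  proof (rule kspace.independent_if_scalars_zero)
    fix c :: "'k mpoly \<Rightarrow> 'k" and x :: "'k mpoly"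
    assume 0: "(\<Sum>x\<in>Indet ` {1..n}. cscale (c x) x) = 0" and "x \<in> Indet ` {1..n}"
    then obtain i where i: "i \<in> {1..n}" "x = Indet i" by blast
    have "0 = Poly_Mapping.lookup (\<Sum>j\<in>{1..n}. cscale (c (Indet j)) (Indet j)) (Indet_pp i)"
      using 0 sum.reindex[OF inj_on_subset[OF inj subset_UNIV], of "\<lambda>x. cscale (c x) x" "{1..n}"]
      by (simp add: comp_def)
    also have "\<dots> = (\<Sum>j\<in>{1..n}. if j = i then c (Indet i) else 0)"
      unfolding lookup_sum by (intro sum.cong) (auto simp: lookup_Indet)
    finally show "c x = 0" using i by simp
  qed simp
  moreover have fin: "finite ?T" using B(1) \<open>finite Y\<close> by simp
  ultimately have "card (Indet ` {1..n} :: 'k mpoly set) \<le> card ?T"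
    using kspace.independent_span_bound[OF fin _ sub] by blast
  also have "\<dots> \<le> card B + card (Lin ` p ` Y)" by (rule card_Un_le)
  also have "card (Lin ` p ` Y) \<le> card Y"
    using card_image_le[of "p ` Y" Lin] card_image_le[of Y p] \<open>finite Y\<close> by simp
  finally show ?thesis by (simp add: card_image inj_on_subset[OF inj subset_UNIV])
qed

section \<open>Correctness for every admissible choice\<close>

theorem corollary4p8:
  fixes n :: nat
    and W :: "nat \<Rightarrow> int"
    and G :: "'k::field mpoly list"
    and I :: "'k mpoly set"
  assumes "positive_grading n W"
    and "\<forall>g\<in>set G. g \<in> irrelevant_ideal n \<and> W_homogeneous W g"
    and "I = Idl\<^bsub>polyring {1..n}\<^esub> (set G)"
  shows
    "(\<exists>fs. step1 I G fs) \<and>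
     (\<forall>fs. step1 I G fs \<longrightarrow>
       (\<exists>fs' Z. step2 n W I fs fs' Z) \<and>
       (\<forall>fs' Z. step2 n W I fs fs' Z \<longrightarrow>
         (\<exists>F. step3 n W fs' Z F) \<and>
         (\<forall>F. step3 n W fs' Z F \<longrightarrow>
           coherently_separating n Z (step4 Z F) \<and>
           (\<forall>f\<in>set (step4 Z F). f \<in> I \<and> W_homogeneous W f) \<and>
           (\<exists>\<Phi>. separating_reembedding n I Z (step4 Z F) \<Phi>) \<and>
           (\<forall>\<Phi>. separating_reembedding n I Z (step4 Z F) \<Phi> \<longrightarrow>
             optimal_reembedding n I ({1..n} - set Z)
               (I \<inter> carrier (polyring ({1..n} - set Z))) \<Phi>))))"
proof -
  have G: "indets g \<subseteq> {1..n} \<and> Poly_Mapping.lookup g 0 = 0" "W_homogeneous W g" if "g \<in> set G" for g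
    using assms(2) that irrelevant_idealD[of g n] by auto
  have I: "ideal I (polyring {1..n})" and GI: "set G \<subseteq> I"
    unfolding assms(3) using G(1) by (intro genideal_polyring; simp)+
  have Lin_I: "Lin_space I = kspace.span (Lin ` set G)"
    unfolding assms(3) by (rule Lin_space_genideal[OF G(1)])
  have fs_G: "set fs \<subseteq> set G" if "step1 I G fs" for fs
    using that by (auto simp: step1_def dest: list_emb_set)
  have step2: "\<exists>fs' Z. step2 n W I fs fs' Z" if "step1 I G fs" for fs
  proof (rule exists_step2)
    show "basis_tuple (map Lin fs) (Lin_space I)" using that by (simp add: step1_def)
    show "indets f \<subseteq> {1..n}" if "f \<in> set fs" for f
      using that fs_G[OF \<open>step1 I G fs\<close>] G(1) by blast
  qed
  have step3: "\<exists>F. step3 n W fs' Z F" if "step1 I G fs" "step2 n W I fs fs' Z" for fs fs' Z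
  proof (rule exists_step3[OF _ that(2)])
    show "basis_tuple (map Lin fs) (Lin_space I)" using that by (simp add: step1_def)
    show "indets f \<subseteq> {1..n} \<and> W_homogeneous W f" if "f \<in> set fs" for f
      using that fs_G[OF \<open>step1 I G fs\<close>] G by blast
  qed
  have step4: "coherently_separating n Z (step4 Z F) \<and>
      (\<forall>f\<in>set (step4 Z F). f \<in> I \<and> W_homogeneous W f) \<and>
      (\<exists>\<Phi>. separating_reembedding n I Z (step4 Z F) \<Phi>) \<and>
      (\<forall>\<Phi>. separating_reembedding n I Z (step4 Z F) \<Phi> \<longrightarrow>
        optimal_reembedding n I ({1..n} - set Z)
          (I \<inter> carrier (polyring ({1..n} - set Z))) \<Phi>)"
    if st: "step1 I G fs" "step2 n W I fs fs' Z" "step3 n W fs' Z F" for fs fs' Z F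
  proof -
    have Z: "distinct Z" "set Z \<subseteq> {1..n}" "sorted (map (\<lambda>z. wdeg W (Indet_pp z)) Z)"
      and ms: "mset fs' = mset fs" and len: "length Z = length fs"
      using st(2) by (auto simp: step2_def top_rank_def)
    have sub: "set fs' \<subseteq> I" using fs_G[OF st(1)] GI mset_eq_setD[OF ms] by blast
    let ?F = "step4 Z F" and ?Y = "{1..n} - set Z"
    have inv: "step4_invariant n W I Z (length Z) ?F"
      by (rule step4_invariant_final[OF I assms(1) Z st(3) sub])
    note F = step4_invariantD[OF inv Z(1,2)]
    have FI: "?F ! k \<in> I" if "k < length Z" for k
      using inv that by (simp add: step4_invariant_def)
    have lenF: "length ?F = length Z" using inv by (simp add: step4_invariant_def)
    have ex: "\<exists>\<Phi>. separating_reembedding n I Z ?F \<Phi>"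
      by (rule exists_separating_reembedding[OF I Z(1,2) lenF FI F(3)])
    \<comment> \<open>\<open>?Y\<close> has \<open>n - s\<close> elements for
      \<open>s = length Z\<close>, while \<open>Lin_space I\<close> is spanned by at most
      \<open>s\<close> linear forms; the lower bound then gives
      \<open>n \<le> s + card Y'\<close>.\<close>
    have "card ?Y + length Z = n"
      using card_Diff_subset[OF _ Z(2)] card_mono[OF _ Z(2)] distinct_card[OF Z(1)] by simp
    moreover have basis: "Lin_space I = kspace.span (set (map Lin fs))"
      using st(1) by (simp add: step1_def basis_tuple_def)
    moreover have "card (set (map Lin fs)) \<le> length Z"
      using card_length[of "map Lin fs"] len by simp
    ultimately have min: "card ?Y \<le> card Y'"
      if "finite Y'" "ideal J' (polyring Y')" "K_alg_iso {1..n} I Y' J' \<Psi>" for Y' J' \<Psi>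
      using K_alg_iso_lower_bound[OF I that(2,3,1) _ basis] by simp
    have "optimal_reembedding n I ?Y (I \<inter> carrier (polyring ?Y)) \<Phi>"
      if "separating_reembedding n I Z ?F \<Phi>" for \<Phi>
      unfolding optimal_reembedding_def
    proof (intro conjI allI impI)
      show "ideal (I \<inter> carrier (polyring ?Y)) (polyring ?Y)"
        by (rule ideal_contraction[OF I]) blast
      show "K_alg_iso {1..n} I ?Y (I \<inter> carrier (polyring ?Y)) \<Phi>"
        using that by (simp add: separating_reembedding_def Let_def)
    qed (use min in blast)+
    with F(1,2) ex show ?thesis by blast
  qed
  show ?thesis using exists_step1[OF Lin_I] step2 step3 step4 by blast
qed

end
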